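(* A power series $f\in\mathbb H[[z]]$ is a Blaschke product of degree $n$ if and only if $\|hf\|_{H^2(\mathbb B_1)}=\|h\|_{H^2(\mathbb B_1)}$ for all $h\in H^2(\mathbb B_1)$ and the left $\mathbb H$-submodule $H^2(\mathbb B_1)\cdot f=\{hf:h\in H^2(\mathbb B_1)\}$ of $H^2(\mathbb B_1)$ has codimension $n$.
   Context: $\mathbb H$ is the skew field of real quaternions with conjugation $\alpha\mapsto\overline\alpha$ and modulus $|\cdot|$; $\mathbb B_1=\{\alpha\in\mathbb H:|\alpha|<1\}$. $\mathbb H[[z]]$ is the ring of formal power series in a variable $z$ commuting with the quaternionic coefficients, with the Cauchy product $(fg)_k=\sum_{\ell=0}^kf_\ell g_{k-\ell}$. $H^2(\mathbb B_1)$ is the set of $h=\sum_kh_kz^k\in\mathbb H[[z]]$ with $\|h\|^2_{H^2(\mathbb B_1)}=\sum_k|h_k|^2<\infty$, regarded here as a left Hilbert $\mathbb H$-module with inner product $[h,g]=\sum_kh_k\overline{g_k}$. Codimension is the dimension over $\mathbb H$ of the orthogonal complement (equivalently, of the quotient left module). For $\alpha\in\mathbb B_1$, the Blaschke factor is ${\bf b}_\alpha(z)=(z-\alpha)\sum_{k\ge0}\overline\alpha^kz^k$. A finite Blaschke product of degree $n\ge0$ is a power series ${\bf b}_{\alpha_1}\cdots{\bf b}_{\alpha_n}\phi$ with $\alpha_1,\dots,\alpha_n\in\mathbb B_1$ and $\phi\in\mathbb H$, $|\phi|=1$ (unimodular constants have degree $0$). *)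

theory Defs
  imports
    "HOL-Analysis.Analysis"
    "HOL-Computational_Algebra.Formal_Power_Series"
begin

section \<open>Real quaternions\<close>

datatype quat = Quat (q0: real) (q1: real) (q2: real) (q3: real)

lemma quat_eq_iff: "x = y \<longleftrightarrow> q0 x = q0 y \<and> q1 x = q1 y \<and> q2 x = q2 y \<and> q3 x = q3 y"
  by (cases x; cases y) simp

instantiation quat :: real_algebra_1
begin

definition zero_quat :: quat where "0 = Quat 0 0 0 0"

definition one_quat :: quat where "1 = Quat 1 0 0 0"

definition plus_quat :: "quat \<Rightarrow> quat \<Rightarrow> quat" where
  "x + y = Quat (q0 x + q0 y) (q1 x + q1 y) (q2 x + q2 y) (q3 x + q3 y)"

definition minus_quat :: "quat \<Rightarrow> quat \<Rightarrow> quat" where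
  "x - y = Quat (q0 x - q0 y) (q1 x - q1 y) (q2 x - q2 y) (q3 x - q3 y)"

definition uminus_quat :: "quat \<Rightarrow> quat" where
  "- x = Quat (- q0 x) (- q1 x) (- q2 x) (- q3 x)"

definition scaleR_quat :: "real \<Rightarrow> quat \<Rightarrow> quat" where
  "r *\<^sub>R x = Quat (r * q0 x) (r * q1 x) (r * q2 x) (r * q3 x)"

definition times_quat :: "quat \<Rightarrow> quat \<Rightarrow> quat" where
  "x * y = Quat
     (q0 x * q0 y - q1 x * q1 y - q2 x * q2 y - q3 x * q3 y)
     (q0 x * q1 y + q1 x * q0 y + q2 x * q3 y - q3 x * q2 y)
     (q0 x * q2 y - q1 x * q3 y + q2 x * q0 y + q3 x * q1 y)
     (q0 x * q3 y + q1 x * q2 y - q2 x * q1 y + q3 x * q0 y)"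

instance
  by standard
    (simp_all add: quat_eq_iff zero_quat_def one_quat_def plus_quat_def minus_quat_def
      uminus_quat_def scaleR_quat_def times_quat_def algebra_simps)

end

lemma quat_sel_zero [simp]: "q0 0 = 0" "q1 0 = 0" "q2 0 = 0" "q3 0 = 0"
  by (simp_all add: zero_quat_def)

lemma quat_sel_one [simp]: "q0 1 = 1" "q1 1 = 0" "q2 1 = 0" "q3 1 = 0"
  by (simp_all add: one_quat_def)

lemma quat_sel_add [simp]:
  "q0 (x + y) = q0 x + q0 y" "q1 (x + y) = q1 x + q1 y"
  "q2 (x + y) = q2 x + q2 y" "q3 (x + y) = q3 x + q3 y"
  by (simp_all add: plus_quat_def)

lemma quat_sel_diff [simp]:
  "q0 (x - y) = q0 x - q0 y" "q1 (x - y) = q1 x - q1 y"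
  "q2 (x - y) = q2 x - q2 y" "q3 (x - y) = q3 x - q3 y"
  by (simp_all add: minus_quat_def)

lemma quat_sel_minus [simp]:
  "q0 (- x) = - q0 x" "q1 (- x) = - q1 x" "q2 (- x) = - q2 x" "q3 (- x) = - q3 x"
  by (simp_all add: uminus_quat_def)

lemma quat_sel_scaleR [simp]:
  "q0 (r *\<^sub>R x) = r * q0 x" "q1 (r *\<^sub>R x) = r * q1 x"
  "q2 (r *\<^sub>R x) = r * q2 x" "q3 (r *\<^sub>R x) = r * q3 x"
  by (simp_all add: scaleR_quat_def)

lemma quat_sel_mult [simp]:
  "q0 (x * y) = q0 x * q0 y - q1 x * q1 y - q2 x * q2 y - q3 x * q3 y"
  "q1 (x * y) = q0 x * q1 y + q1 x * q0 y + q2 x * q3 y - q3 x * q2 y"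
  "q2 (x * y) = q0 x * q2 y - q1 x * q3 y + q2 x * q0 y + q3 x * q1 y"
  "q3 (x * y) = q0 x * q3 y + q1 x * q2 y - q2 x * q1 y + q3 x * q0 y"
  by (simp_all add: times_quat_def)

text \<open>The real inner product below only serves to give the modulus and the topology of the
  quaternions; it is not the quaternion-valued inner product of the Hardy space.\<close>

instantiation quat :: real_inner
begin

definition inner_quat :: "quat \<Rightarrow> quat \<Rightarrow> real" where
  "inner x y = q0 x * q0 y + q1 x * q1 y + q2 x * q2 y + q3 x * q3 y"

definition norm_quat :: "quat \<Rightarrow> real" where
  "norm x = sqrt ((q0 x)\<^sup>2 + (q1 x)\<^sup>2 + (q2 x)\<^sup>2 + (q3 x)\<^sup>2)"

definition sgn_quat :: "quat \<Rightarrow> quat" where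
  "sgn (x :: quat) = x /\<^sub>R norm x"

definition dist_quat :: "quat \<Rightarrow> quat \<Rightarrow> real" where
  "dist (x :: quat) y = norm (x - y)"

definition uniformity_quat :: "(quat \<times> quat) filter" where
  "(uniformity :: (quat \<times> quat) filter) = (INF e\<in>{0 <..}. principal {(x, y :: quat). dist x y < e})"

definition open_quat :: "quat set \<Rightarrow> bool" where
  "open (U :: quat set) \<longleftrightarrow> (\<forall>x\<in>U. eventually (\<lambda>(x', y). x' = x \<longrightarrow> y \<in> U) uniformity)"

instance
proof
  fix x y z :: quat and r :: real and U :: "quat set"
  show "inner x y = inner y x"
    by (simp add: inner_quat_def algebra_simps)
  show "inner (x + y) z = inner x z + inner y z"
    by (simp add: inner_quat_def algebra_simps)
  show "inner (r *\<^sub>R x) y = r * inner x y"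
    by (simp add: inner_quat_def algebra_simps)
  show "0 \<le> inner x x"
    by (simp add: inner_quat_def)
  show "inner x x = 0 \<longleftrightarrow> x = 0"
    by (simp add: inner_quat_def quat_eq_iff add_nonneg_eq_0_iff)
  show "norm x = sqrt (inner x x)"
    by (simp add: inner_quat_def norm_quat_def power2_eq_square)
qed (rule sgn_quat_def dist_quat_def open_quat_def uniformity_quat_def)+

end

instantiation quat :: euclidean_space
begin

definition Basis_quat :: "quat set" where
  "Basis = {Quat 1 0 0 0, Quat 0 1 0 0, Quat 0 0 1 0, Quat 0 0 0 1}"

instance
proof
  fix u v x :: quat
  show "(Basis :: quat set) \<noteq> {}" "finite (Basis :: quat set)"
    by (simp_all add: Basis_quat_def)
  show "u \<in> Basis \<Longrightarrow> v \<in> Basis \<Longrightarrow> inner u v = (if u = v then 1 else 0)"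
    unfolding Basis_quat_def by (elim insertE emptyE) (simp_all add: inner_quat_def)
  show "(\<forall>u\<in>Basis. inner x u = 0) \<longleftrightarrow> x = 0"
    by (simp add: Basis_quat_def inner_quat_def quat_eq_iff [of x 0])
qed

end

definition qcnj :: "quat \<Rightarrow> quat" where
  "qcnj x = Quat (q0 x) (- q1 x) (- q2 x) (- q3 x)"

lemma qcnj_sel [simp]:
  "q0 (qcnj x) = q0 x" "q1 (qcnj x) = - q1 x" "q2 (qcnj x) = - q2 x" "q3 (qcnj x) = - q3 x"
  by (simp_all add: qcnj_def)

lemma norm_quat_squared: "(norm x)\<^sup>2 = (q0 x)\<^sup>2 + (q1 x)\<^sup>2 + (q2 x)\<^sup>2 + (q3 x)\<^sup>2"
  by (simp add: norm_quat_def)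

lemma quat_mult_qcnj: "x * qcnj x = (norm x)\<^sup>2 *\<^sub>R 1"
  and quat_qcnj_mult: "qcnj x * x = (norm x)\<^sup>2 *\<^sub>R 1"
  by (simp_all add: quat_eq_iff norm_quat_squared flip: power2_eq_square)

lemma euler_four_square:
  fixes a b c d p q r s :: real
  shows "(a * p - b * q - c * r - d * s)\<^sup>2 + (a * q + b * p + c * s - d * r)\<^sup>2 +
      (a * r - b * s + c * p + d * q)\<^sup>2 + (a * s + b * r - c * q + d * p)\<^sup>2 =
    (a\<^sup>2 + b\<^sup>2 + c\<^sup>2 + d\<^sup>2) * (p\<^sup>2 + q\<^sup>2 + r\<^sup>2 + s\<^sup>2)"
  by algebra

instantiation quat :: real_normed_div_algebra
begin

definition inverse_quat :: "quat \<Rightarrow> quat" where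
  "inverse x = qcnj x /\<^sub>R (norm x)\<^sup>2"

definition divide_quat :: "quat \<Rightarrow> quat \<Rightarrow> quat" where
  "x div y = x * inverse (y :: quat)"

instance
proof
  fix x y :: quat
  show "x \<noteq> 0 \<Longrightarrow> inverse x * x = 1" "x \<noteq> 0 \<Longrightarrow> x * inverse x = 1"
    by (simp_all add: inverse_quat_def quat_mult_qcnj quat_qcnj_mult)
  show "x div y = x * inverse y"
    by (rule divide_quat_def)
  show "inverse (0 :: quat) = 0"
    by (simp add: inverse_quat_def)
  show "norm (x * y) = norm x * norm y"
    by (simp add: norm_quat_def euler_four_square flip: real_sqrt_mult)
qed

end


section \<open>The Hardy space of the unit ball\<close>

definition hardy2 :: "quat fps set" where
  "hardy2 = {h. summable (\<lambda>k. (norm (fps_nth h k))\<^sup>2)}"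

text \<open>The norm and the inner product are meaningful on \<open>hardy2\<close> only.\<close>

definition hardy2_norm :: "quat fps \<Rightarrow> real" where
  "hardy2_norm h = sqrt (\<Sum>k. (norm (fps_nth h k))\<^sup>2)"

definition hardy2_inner :: "quat fps \<Rightarrow> quat fps \<Rightarrow> quat" where
  "hardy2_inner h g = (\<Sum>k. fps_nth h k * qcnj (fps_nth g k))"

definition hardy2_orth :: "quat fps set \<Rightarrow> quat fps set" where
  "hardy2_orth M = {g \<in> hardy2. \<forall>h\<in>M. hardy2_inner h g = 0}"


section \<open>Dimension and codimension of left modules\<close>

text \<open>The library's linear algebra is restricted to commutative scalars, so that left linear
  independence, left spans and bases over the quaternions are introduced here. The scalar
  \<open>c\<close> acts on power series as left multiplication by the constant series \<open>fps_const c\<close>.\<close>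

definition left_independent :: "quat fps set \<Rightarrow> bool" where
  "left_independent B \<longleftrightarrow>
     (\<forall>c. (\<Sum>b\<in>B. fps_const (c b) * b) = 0 \<longrightarrow> (\<forall>b\<in>B. c b = 0))"

definition left_span :: "quat fps set \<Rightarrow> quat fps set" where
  "left_span B = {(\<Sum>b\<in>B. fps_const (c b) * b) | c. True}"

text \<open>Both notions are used for finite \<open>B\<close> only. Dimension is a relation, so that no value
  is assigned to spaces without a finite basis.\<close>

definition has_left_dim :: "quat fps set \<Rightarrow> nat \<Rightarrow> bool" where
  "has_left_dim V n \<longleftrightarrow>
     (\<exists>B. finite B \<and> card B = n \<and> left_independent B \<and> left_span B = V)"

definition has_left_codim :: "quat fps set \<Rightarrow> nat \<Rightarrow> bool" where
  "has_left_codim M n \<longleftrightarrow> has_left_dim (hardy2_orth M) n"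


section \<open>Finite Blaschke products\<close>

definition blaschke_factor :: "quat \<Rightarrow> quat fps" where
  "blaschke_factor \<alpha> = (fps_X - fps_const \<alpha>) * Abs_fps (\<lambda>k. qcnj \<alpha> ^ k)"

definition blaschke_product :: "nat \<Rightarrow> quat fps \<Rightarrow> bool" where
  "blaschke_product n f \<longleftrightarrow>
     (\<exists>\<alpha>s \<phi>. length \<alpha>s = n \<and> (\<forall>\<alpha>\<in>set \<alpha>s. norm \<alpha> < 1) \<and> norm \<phi> = 1 \<and>
        f = prod_list (map blaschke_factor \<alpha>s) * fps_const \<phi>)"

end

theory Submission
  imports Defs "HOL-Computational_Algebra.Fundamental_Theorem_Algebra"
begin

text \<open>Write \<open>K\<^sub>f\<close> for the orthogonal complement of \<open>H\<^sup>2 f\<close> and \<open>k\<^sub>\<alpha>\<close> for the Szego kernel whose coefficients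
  are the powers of the conjugate of \<open>\<alpha>\<close>. A telescoping sum shows that \<open>b\<^sub>\<alpha>\<close> multiplies isometrically, and
  \<open>H\<^sup>2 b\<^sub>\<alpha>\<close> is exactly the orthogonal complement of \<open>k\<^sub>\<alpha>\<close>. Hence \<open>K\<^bsub>bg\<^esub>\<close> is the direct sum of \<open>K\<^sub>g\<close> and the
  line spanned by \<open>k\<^sub>\<alpha> g\<close>, for \<open>b = b\<^sub>\<alpha>\<close>, so a Blaschke product of degree \<open>n\<close> has codimension \<open>n\<close>.

  Conversely, if \<open>f\<close> is isometric then \<open>K\<^sub>f\<close> is invariant under the backward shift and contains the
  backward shift of \<open>f\<close>. If \<open>K\<^sub>f = 0\<close>, this makes \<open>f\<close> constant. Otherwise the backward shift has an
  eigenvector in \<open>K\<^sub>f\<close>, found by restricting scalars to the complex numbers; it is a left multiple of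
  some \<open>k\<^sub>\<alpha>\<close>, so \<open>f = g b\<^sub>\<alpha>\<close> with \<open>g\<close> isometric, and \<open>K\<^sub>g b\<^sub>\<alpha>\<close> is the part of \<open>K\<^sub>f\<close> orthogonal to \<open>k\<^sub>\<alpha>\<close>. Induction
  applies, since unimodular constants can be moved past Blaschke factors by conjugating \<open>\<alpha>\<close>.\<close>

section \<open>Quaternions and the Hardy space\<close>

lemma qcnj_0 [simp]: "qcnj 0 = 0" and qcnj_1 [simp]: "qcnj 1 = 1"
  by (simp_all add: quat_eq_iff)

lemma qcnj_qcnj [simp]: "qcnj (qcnj x) = x"
  by (simp add: quat_eq_iff)

lemma qcnj_add: "qcnj (x + y) = qcnj x + qcnj y"
  by (simp add: quat_eq_iff)

lemma qcnj_diff: "qcnj (x - y) = qcnj x - qcnj y"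
  by (simp add: quat_eq_iff)

lemma qcnj_mult: "qcnj (x * y) = qcnj y * qcnj x"
  by (simp add: quat_eq_iff algebra_simps)

lemma qcnj_power: "qcnj (x ^ n) = qcnj x ^ n"
  by (induction n) (simp_all add: qcnj_mult power_commutes)

lemma norm_qcnj [simp]: "norm (qcnj x) = norm x"
  by (simp add: norm_quat_def)

lemma bounded_linear_qcnj: "bounded_linear qcnj"
  by (intro bounded_linear_intro [where K = 1]) (auto simp: qcnj_add quat_eq_iff)

lemma bounded_linear_q0: "bounded_linear q0"
proof (intro bounded_linear_intro [where K = 1])
  fix x :: quat
  have "\<bar>q0 x\<bar> = sqrt ((q0 x)\<^sup>2)" by simp
  also have "\<dots> \<le> norm x" unfolding norm_quat_def by (intro real_sqrt_le_mono) simp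
  finally show "norm (q0 x) \<le> norm x * 1" by simp
qed auto

lemma mult_qcnj_of_real: "x * qcnj x = of_real ((norm x)\<^sup>2)"
  by (simp add: quat_mult_qcnj of_real_def)

lemma norm_add_power2_quat: "(norm (x + y))\<^sup>2 = (norm x)\<^sup>2 + (norm y)\<^sup>2 + 2 * q0 (x * qcnj y)" for x y :: quat
  by (simp add: norm_quat_squared) algebra

section \<open>The Hardy space as a left module with an inner product\<close>

lemma hardy2_summable: "h \<in> hardy2 \<Longrightarrow> summable (\<lambda>k. (norm (fps_nth h k))\<^sup>2)"
  by (simp add: hardy2_def)

lemma hardy2_inner_summable:
  assumes "h \<in> hardy2" "g \<in> hardy2"
  shows "summable (\<lambda>k. fps_nth h k * qcnj (fps_nth g k))"
proof (rule summable_comparison_test [where g = "\<lambda>k. (norm (fps_nth h k))\<^sup>2 + (norm (fps_nth g k))\<^sup>2"])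
  have "norm (fps_nth h k * qcnj (fps_nth g k)) \<le> (norm (fps_nth h k))\<^sup>2 + (norm (fps_nth g k))\<^sup>2" for k
  proof -
    have "2 * (norm (fps_nth h k) * norm (fps_nth g k)) \<le> (norm (fps_nth h k))\<^sup>2 + (norm (fps_nth g k))\<^sup>2"
      using sum_squares_bound [of "norm (fps_nth h k)" "norm (fps_nth g k)"] by (simp add: mult.assoc)
    moreover have "0 \<le> norm (fps_nth h k) * norm (fps_nth g k)" by simp
    ultimately have "norm (fps_nth h k) * norm (fps_nth g k) \<le> (norm (fps_nth h k))\<^sup>2 + (norm (fps_nth g k))\<^sup>2"
      by linarith
    then show ?thesis by (simp add: norm_mult)
  qed
  then show "\<exists>N. \<forall>n\<ge>N. norm (fps_nth h n * qcnj (fps_nth g n)) \<le> (norm (fps_nth h n))\<^sup>2 + (norm (fps_nth g n))\<^sup>2"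
    by blast
qed (use assms in \<open>auto simp: hardy2_def intro: summable_add\<close>)

lemma hardy2_0 [simp]: "0 \<in> hardy2"
  by (simp add: hardy2_def)

lemma hardy2_const [simp]: "fps_const c \<in> hardy2"
  unfolding hardy2_def mem_Collect_eq by (rule summable_finite [where N = "{0}"]) auto

lemma hardy2_1 [simp]: "1 \<in> hardy2"
  using hardy2_const [of 1] by simp

lemma hardy2_add:
  assumes "h \<in> hardy2" "g \<in> hardy2"
  shows "h + g \<in> hardy2"
proof -
  have "summable (\<lambda>k. q0 (fps_nth h k * qcnj (fps_nth g k)))"
    using bounded_linear.summable [OF bounded_linear_q0 hardy2_inner_summable [OF assms]] .
  then have "summable (\<lambda>k. (norm (fps_nth h k))\<^sup>2 + (norm (fps_nth g k))\<^sup>2 + 2 * q0 (fps_nth h k * qcnj (fps_nth g k)))"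
    by (intro summable_add summable_mult hardy2_summable assms)
  then show ?thesis
    unfolding hardy2_def by (simp add: norm_add_power2_quat del: quat_sel_mult)
qed

lemma hardy2_const_mult: "h \<in> hardy2 \<Longrightarrow> fps_const c * h \<in> hardy2"
  by (simp add: hardy2_def norm_mult power_mult_distrib summable_mult)

lemma hardy2_mult_const: "h \<in> hardy2 \<Longrightarrow> h * fps_const c \<in> hardy2"
  by (simp add: hardy2_def norm_mult power_mult_distrib summable_mult2)

lemma hardy2_uminus: "h \<in> hardy2 \<Longrightarrow> - h \<in> hardy2"
  by (simp add: hardy2_def)

lemma hardy2_diff: "h \<in> hardy2 \<Longrightarrow> g \<in> hardy2 \<Longrightarrow> h - g \<in> hardy2"
  using hardy2_add [of h "- g"] hardy2_uminus [of g] by simp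

lemma hardy2_fps_X_mult:
  assumes "h \<in> hardy2"
  shows "fps_X * h \<in> hardy2"
proof -
  have "summable (\<lambda>k. (norm (fps_nth (fps_X * h) (Suc k)))\<^sup>2)"
    using hardy2_summable [OF assms] by simp
  then show ?thesis unfolding hardy2_def mem_Collect_eq by (subst (asm) summable_Suc_iff)
qed

lemma hardy2_shift: "h \<in> hardy2 \<Longrightarrow> fps_shift 1 h \<in> hardy2"
  using summable_Suc_iff [of "\<lambda>k. (norm (fps_nth h k))\<^sup>2"] by (simp add: hardy2_def)

lemma hardy2_inner_add_left:
  "\<lbrakk>h \<in> hardy2; h' \<in> hardy2; g \<in> hardy2\<rbrakk> \<Longrightarrow> hardy2_inner (h + h') g = hardy2_inner h g + hardy2_inner h' g"
  by (simp add: hardy2_inner_def distrib_right suminf_add hardy2_inner_summable)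

lemma hardy2_inner_add_right:
  "\<lbrakk>h \<in> hardy2; g' \<in> hardy2; g \<in> hardy2\<rbrakk> \<Longrightarrow> hardy2_inner h (g + g') = hardy2_inner h g + hardy2_inner h g'"
  by (simp add: hardy2_inner_def distrib_left qcnj_add suminf_add hardy2_inner_summable)

lemma hardy2_inner_const_left:
  "\<lbrakk>h \<in> hardy2; g \<in> hardy2\<rbrakk> \<Longrightarrow> hardy2_inner (fps_const c * h) g = c * hardy2_inner h g"
  by (simp add: hardy2_inner_def mult.assoc suminf_mult hardy2_inner_summable)

lemma hardy2_inner_const_right:
  "\<lbrakk>h \<in> hardy2; g \<in> hardy2\<rbrakk> \<Longrightarrow> hardy2_inner h (fps_const c * g) = hardy2_inner h g * qcnj c"
  by (simp add: hardy2_inner_def qcnj_mult suminf_mult2 hardy2_inner_summable flip: mult.assoc)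

lemma hardy2_inner_commute:
  "\<lbrakk>h \<in> hardy2; g \<in> hardy2\<rbrakk> \<Longrightarrow> hardy2_inner h g = qcnj (hardy2_inner g h)"
  unfolding hardy2_inner_def
  by (subst bounded_linear.suminf [OF bounded_linear_qcnj]) (simp_all add: hardy2_inner_summable qcnj_mult)

lemma hardy2_inner_diff_left:
  "\<lbrakk>h \<in> hardy2; h' \<in> hardy2; g \<in> hardy2\<rbrakk> \<Longrightarrow> hardy2_inner (h - h') g = hardy2_inner h g - hardy2_inner h' g"
  using hardy2_inner_add_left [of "h - h'" h' g] by (simp add: hardy2_diff algebra_simps)

lemma hardy2_inner_diff_right:
  "\<lbrakk>h \<in> hardy2; g' \<in> hardy2; g \<in> hardy2\<rbrakk> \<Longrightarrow> hardy2_inner h (g - g') = hardy2_inner h g - hardy2_inner h g'"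
  using hardy2_inner_add_right [of h g' "g - g'"] by (simp add: hardy2_diff algebra_simps)

lemma hardy2_inner_0 [simp]: "hardy2_inner 0 g = 0" "hardy2_inner h 0 = 0"
  by (simp_all add: hardy2_inner_def)

lemma hardy2_inner_self:
  assumes "h \<in> hardy2"
  shows "hardy2_inner h h = of_real ((hardy2_norm h)\<^sup>2)"
proof -
  have "(hardy2_norm h)\<^sup>2 = (\<Sum>k. (norm (fps_nth h k))\<^sup>2)"
    using suminf_nonneg [OF hardy2_summable [OF assms]] by (simp add: hardy2_norm_def)
  then show ?thesis
    by (simp add: hardy2_inner_def mult_qcnj_of_real suminf_of_real [OF hardy2_summable [OF assms]] del: of_real_power)
qed

lemma hardy2_inner_self_eq_0:
  assumes "h \<in> hardy2" "hardy2_inner h h = 0"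
  shows "h = 0"
proof -
  have "(\<Sum>k. (norm (fps_nth h k))\<^sup>2) = 0"
    using assms by (simp add: hardy2_inner_self hardy2_norm_def)
  then show ?thesis
    using suminf_eq_zero_iff [OF hardy2_summable [OF assms(1)]] by (simp add: fps_eq_iff)
qed

text \<open>The constant coefficient of \<open>fps_X * h\<close> is 0, so the head of the series
  drops out: the backward shift is the adjoint of multiplication by z.\<close>

lemma hardy2_inner_shift_right:
  assumes "h \<in> hardy2" "g \<in> hardy2"
  shows "hardy2_inner (fps_X * h) g = hardy2_inner h (fps_shift 1 g)"
  using suminf_split_head [OF hardy2_inner_summable [OF hardy2_fps_X_mult [OF assms(1)] assms(2)]]
  by (simp add: hardy2_inner_def)

section \<open>Norm-preserving right multipliers\<close>

definition isometric_multiplier :: "quat fps \<Rightarrow> bool" where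
  "isometric_multiplier f \<longleftrightarrow> (\<forall>h\<in>hardy2. h * f \<in> hardy2 \<and> hardy2_norm (h * f) = hardy2_norm h)"

lemma isometric_multiplier_mem: "isometric_multiplier f \<Longrightarrow> h \<in> hardy2 \<Longrightarrow> h * f \<in> hardy2"
  by (simp add: isometric_multiplier_def)

lemma isometric_multiplier_self_mem: "isometric_multiplier f \<Longrightarrow> f \<in> hardy2"
  using isometric_multiplier_mem [of f 1] by simp

lemma isometric_multiplier_mult:
  "isometric_multiplier f \<Longrightarrow> isometric_multiplier g \<Longrightarrow> isometric_multiplier (f * g)"
  by (simp add: isometric_multiplier_def flip: mult.assoc)

lemma isometric_multiplier_const: "norm c = 1 \<Longrightarrow> isometric_multiplier (fps_const c)"
  by (simp add: isometric_multiplier_def hardy2_mult_const hardy2_norm_def norm_mult)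

text \<open>Polarization: expand both sides of \<open>\<parallel>(h + cg)f\<parallel> = \<parallel>h + cg\<parallel>\<close>, where \<open>c\<close> is the difference of
  the two inner products.\<close>

lemma isometric_multiplier_inner:
  assumes "isometric_multiplier f" "h \<in> hardy2" "g \<in> hardy2"
  shows "hardy2_inner (h * f) (g * f) = hardy2_inner h g"
proof -
  define c where "c = hardy2_inner (h * f) (g * f) - hardy2_inner h g"
  have expand: "hardy2_inner (u + fps_const c * v) (u + fps_const c * v) =
      hardy2_inner u u + hardy2_inner u v * qcnj c + c * hardy2_inner v u + c * hardy2_inner v v * qcnj c"
    if "u \<in> hardy2" "v \<in> hardy2" for u v
    using that by (simp add: hardy2_inner_add_left hardy2_inner_add_right hardy2_inner_const_left
        hardy2_inner_const_right hardy2_const_mult hardy2_add algebra_simps)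
  have iso: "hardy2_inner (u * f) (u * f) = hardy2_inner u u" if "u \<in> hardy2" for u
    using assms(1) that by (simp add: hardy2_inner_self isometric_multiplier_def)
  have mem: "h * f \<in> hardy2" "g * f \<in> hardy2"
    using assms by (auto simp: isometric_multiplier_mem)
  have "hardy2_inner (h * f + fps_const c * (g * f)) (h * f + fps_const c * (g * f)) =
      hardy2_inner (h + fps_const c * g) (h + fps_const c * g)"
    using iso [of "h + fps_const c * g"] assms
    by (simp add: hardy2_add hardy2_const_mult distrib_right mult.assoc)
  then have "hardy2_inner (h * f) (g * f) * qcnj c + c * hardy2_inner (g * f) (h * f) =
      hardy2_inner h g * qcnj c + c * hardy2_inner g h"
    by (simp add: expand mem assms iso)
  \<comment> \<open>The pure terms have cancelled because f is isometric; the mixed terms of the two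
    sides differ by exactly twice |c|^2.\<close>
  then have "c * qcnj c + c * qcnj c = 0"
    by (simp add: hardy2_inner_commute [of "g * f"] hardy2_inner_commute [of g] mem assms)
       (simp add: c_def qcnj_diff algebra_simps)
  then have "q0 (c * qcnj c + c * qcnj c) = 0"
    by simp
  then have "c = 0"
    by (simp add: quat_mult_qcnj del: quat_sel_mult)
  then show ?thesis by (simp add: c_def)
qed

section \<open>Blaschke factors\<close>

text \<open>Summing the recursion over an initial segment gives S <= a 0 + r S + sum of c for the
  partial sum S; as r < 1, the term r S can be absorbed on the left.\<close>

lemma summable_if_contracting_forward:
  fixes a c :: "nat \<Rightarrow> real"
  assumes a: "\<And>k. 0 \<le> a k" and step: "\<And>k. a (Suc k) \<le> r * a k + c k"
    and r: "0 \<le> r" "r < 1" and c: "summable c" "\<And>k. 0 \<le> c k"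
  shows "summable a"
proof (rule summableI_nonneg_bounded)
  fix n
  have "(1 - r) * (\<Sum>i<n. a i) \<le> a 0 + suminf c"
  proof (cases n)
    case 0
    then show ?thesis using a c by (simp add: suminf_nonneg)
  next
    case (Suc m)
    have "(\<Sum>i<n. a i) = a 0 + (\<Sum>i<m. a (Suc i))"
      unfolding Suc by (rule sum.lessThan_Suc_shift)
    also have "\<dots> \<le> a 0 + (\<Sum>i<m. r * a i + c i)"
      using step by (intro add_left_mono sum_mono)
    also have "\<dots> = a 0 + r * (\<Sum>i<m. a i) + (\<Sum>i<m. c i)"
      by (simp add: sum.distrib sum_distrib_left)
    also have "\<dots> \<le> a 0 + r * (\<Sum>i<n. a i) + suminf c"
      using a c r unfolding Suc by (intro add_mono mult_left_mono sum_le_suminf) auto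
    finally show ?thesis by (simp add: algebra_simps)
  qed
  then show "(\<Sum>i<n. a i) \<le> (a 0 + suminf c) / (1 - r)"
    using r by (simp add: field_simps)
qed (rule a)

text \<open>The same absorption, but the recursion now bounds each term by its successor. Summing
  leaves a boundary term \<open>r * a n\<close>, which the uniform bound M controls.\<close>

lemma summable_if_contracting_backward:
  fixes a c :: "nat \<Rightarrow> real"
  assumes a: "\<And>k. 0 \<le> a k" "\<And>k. a k \<le> M" and step: "\<And>k. a k \<le> r * a (Suc k) + c k"
    and r: "0 \<le> r" "r < 1" and c: "summable c" "\<And>k. 0 \<le> c k"
  shows "summable a"
proof (rule summableI_nonneg_bounded)
  fix n
  have "(\<Sum>i<n. a i) \<le> (\<Sum>i<n. r * a (Suc i) + c i)"
    using step by (intro sum_mono)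
  also have "\<dots> = r * (\<Sum>i<n. a (Suc i)) + (\<Sum>i<n. c i)"
    by (simp add: sum.distrib sum_distrib_left)
  also have "(\<Sum>i<n. a (Suc i)) = (\<Sum>i<n. a i) + a n - a 0"
    using sum.lessThan_Suc_shift [of a n] by simp
  also have "r * \<dots> + (\<Sum>i<n. c i) \<le> r * ((\<Sum>i<n. a i) + M) + suminf c"
    using a(1) [of 0] a(2) [of n] r c by (intro add_mono mult_left_mono sum_le_suminf) auto
  finally show "(\<Sum>i<n. a i) \<le> (r * M + suminf c) / (1 - r)"
    using r by (simp add: field_simps)
qed (rule a)

text \<open>Convexity of the square, applied to x + r y = (1 - r) (x / (1 - r)) + r y. It turns a
  recursion for moduli with ratio r into one for squared moduli with the same ratio.\<close>

lemma power2_add_contracting: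
  fixes x y r :: real
  assumes "0 \<le> r" "r < 1"
  shows "(x + r * y)\<^sup>2 \<le> r * y\<^sup>2 + x\<^sup>2 / (1 - r)"
proof -
  have "0 \<le> r * (x - (1 - r) * y)\<^sup>2"
    using assms by simp
  also have "\<dots> = (1 - r) * (r * y\<^sup>2) + x\<^sup>2 - (1 - r) * (x + r * y)\<^sup>2"
    by algebra
  finally show ?thesis
    using assms by (simp add: field_simps)
qed

section \<open>Szego kernels and the Blaschke factors built from them\<close>

definition szego :: "quat \<Rightarrow> quat fps" where
  "szego \<alpha> = Abs_fps (\<lambda>k. qcnj \<alpha> ^ k)"

lemma szego_nth [simp]: "fps_nth (szego \<alpha>) k = qcnj \<alpha> ^ k"
  by (simp add: szego_def)

lemma blaschke_factor_eq: "blaschke_factor \<alpha> = (fps_X - fps_const \<alpha>) * szego \<alpha>"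
  by (simp add: blaschke_factor_def szego_def)

lemma szego_mem:
  assumes "norm \<alpha> < 1"
  shows "szego \<alpha> \<in> hardy2"
proof -
  have "summable (\<lambda>k. ((norm \<alpha>)\<^sup>2) ^ k)"
    using assms by (intro summable_geometric) (simp add: abs_square_less_1)
  then show ?thesis
    by (simp add: hardy2_def norm_power mult.commute flip: power_mult)
qed

lemma szego_nonzero: "szego \<alpha> \<noteq> 0"
proof
  assume "szego \<alpha> = 0"
  then have "fps_nth (szego \<alpha>) 0 = 0" by simp
  then show False by simp
qed

text \<open>Geometric series. The coefficients do not commute, so the inverse is checked on each
  side separately.\<close>

lemma szego_mult: "szego \<alpha> * (1 - fps_X * fps_const (qcnj \<alpha>)) = 1"
  by (rule fps_ext) (auto simp: algebra_simps simp flip: power_Suc2 mult.assoc intro: power_minus_mult)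

lemma mult_szego: "(1 - fps_X * fps_const (qcnj \<alpha>)) * szego \<alpha> = 1"
  by (rule fps_ext) (auto simp: algebra_simps mult.assoc simp flip: power_Suc)

text \<open>Besides the central z, only \<alpha> and its conjugate occur, and these commute: both of
  their products are |\<alpha>|^2.\<close>

lemma linear_factors_commute:
  "(fps_X - fps_const \<alpha>) * (1 - fps_X * fps_const (qcnj \<alpha>)) =
    (1 - fps_X * fps_const (qcnj \<alpha>)) * (fps_X - fps_const \<alpha>)"
proof -
  have X: "fps_const c * fps_X = fps_X * fps_const c" for c :: quat
    by (rule fps_mult_fps_X_commute [symmetric])
  have X': "fps_const c * (fps_X * p) = fps_X * (fps_const c * p)" for c :: quat and p
    by (simp add: X flip: mult.assoc)
  show ?thesis
    by (simp add: left_diff_distrib right_diff_distrib mult.assoc X X' quat_mult_qcnj quat_qcnj_mult)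
qed

text \<open>With the kernel on the left, \<open>h * blaschke_factor \<alpha>\<close> becomes
  \<open>h * szego \<alpha>\<close> times a linear factor, so its coefficients satisfy a two-term
  formula.\<close>

lemma blaschke_factor_eq': "blaschke_factor \<alpha> = szego \<alpha> * (fps_X - fps_const \<alpha>)"
proof -
  let ?d = "1 - fps_X * fps_const (qcnj \<alpha>)"
  have "blaschke_factor \<alpha> = szego \<alpha> * (?d * (fps_X - fps_const \<alpha>)) * szego \<alpha>"
    by (simp add: blaschke_factor_eq szego_mult flip: mult.assoc)
  also have "\<dots> = szego \<alpha> * (fps_X - fps_const \<alpha>) * (?d * szego \<alpha>)"
    by (simp add: mult.assoc flip: linear_factors_commute)
  finally show ?thesis by (simp add: mult_szego)
qed

lemma blaschke_factor_nonzero: "blaschke_factor \<alpha> \<noteq> 0"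
  by (simp add: blaschke_factor_eq szego_nonzero)

text \<open>The cross terms of the two squares are real parts of conjugate quaternions and
  cancel.\<close>

lemma norm_blaschke_identity:
  "(norm (u - v * qcnj \<alpha>))\<^sup>2 - (norm (v - u * \<alpha>))\<^sup>2 = (1 - (norm \<alpha>)\<^sup>2) * ((norm u)\<^sup>2 - (norm v)\<^sup>2)"
  by (simp add: norm_quat_squared) algebra

text \<open>The product u satisfies u_(k+1) = h_(k+1) + u_k times the conjugate of \<alpha>, a
  forward recursion with ratio |\<alpha>| < 1.\<close>

lemma mult_szego_mem:
  assumes "norm \<alpha> < 1" "h \<in> hardy2"
  shows "h * szego \<alpha> \<in> hardy2"
proof -
  define u where "u = h * szego \<alpha>"
  have h: "h = u * (1 - fps_X * fps_const (qcnj \<alpha>))"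
    by (simp add: u_def mult.assoc szego_mult)
  have "summable (\<lambda>k. (norm (fps_nth u k))\<^sup>2)"
  proof (rule summable_if_contracting_forward)
    fix k
    have "fps_nth u (Suc k) = fps_nth h (Suc k) + fps_nth u k * qcnj \<alpha>"
      by (simp add: h algebra_simps flip: mult.assoc)
    then have "norm (fps_nth u (Suc k)) \<le> norm (fps_nth h (Suc k)) + norm \<alpha> * norm (fps_nth u k)"
      using norm_triangle_ineq [of "fps_nth h (Suc k)" "fps_nth u k * qcnj \<alpha>"]
      by (simp add: norm_mult mult.commute)
    then have "(norm (fps_nth u (Suc k)))\<^sup>2 \<le> (norm (fps_nth h (Suc k)) + norm \<alpha> * norm (fps_nth u k))\<^sup>2"
      by (intro power_mono) auto
    also have "\<dots> \<le> norm \<alpha> * (norm (fps_nth u k))\<^sup>2 + (norm (fps_nth h (Suc k)))\<^sup>2 / (1 - norm \<alpha>)"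
      using assms(1) by (intro power2_add_contracting) auto
    finally show "(norm (fps_nth u (Suc k)))\<^sup>2 \<le>
        norm \<alpha> * (norm (fps_nth u k))\<^sup>2 + (norm (fps_nth h (Suc k)))\<^sup>2 / (1 - norm \<alpha>)" .
  next
    show "summable (\<lambda>k. (norm (fps_nth h (Suc k)))\<^sup>2 / (1 - norm \<alpha>))"
      using hardy2_summable [OF hardy2_shift [OF assms(2)]] by (simp add: summable_divide)
  qed (use assms(1) in auto)
  then show ?thesis by (simp add: hardy2_def u_def)
qed

lemma isometric_multiplier_blaschke_factor:
  assumes "norm \<alpha> < 1"
  shows "isometric_multiplier (blaschke_factor \<alpha>)"
  unfolding isometric_multiplier_def
proof
  fix h assume h_mem: "h \<in> hardy2"
  define u where "u = h * szego \<alpha>"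
  define g where "g = h * blaschke_factor \<alpha>"
  have u_mem: "u \<in> hardy2"
    unfolding u_def using assms h_mem by (rule mult_szego_mem)
  have h: "h = u * (1 - fps_X * fps_const (qcnj \<alpha>))"
    by (simp add: u_def mult.assoc szego_mult)
  have g: "g = u * (fps_X - fps_const \<alpha>)"
    by (simp add: u_def g_def blaschke_factor_eq' mult.assoc)
  \<comment> \<open>Both h and g are u times a linear factor, so their k-th coefficients involve
    only u_k and u_(k-1). The differences of squares telescope, and the remaining boundary term
    tends to 0 because u is square summable.\<close>
  have telescope: "(\<Sum>k<Suc N. (norm (fps_nth g k))\<^sup>2) =
      (\<Sum>k<Suc N. (norm (fps_nth h k))\<^sup>2) - (1 - (norm \<alpha>)\<^sup>2) * (norm (fps_nth u N))\<^sup>2" for N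
  proof (induction N)
    case 0
    show ?case
      using norm_blaschke_identity [of "fps_nth u 0" 0 \<alpha>] by (simp add: g h algebra_simps)
  next
    case (Suc N)
    have "(norm (fps_nth h (Suc N)))\<^sup>2 - (norm (fps_nth g (Suc N)))\<^sup>2 =
        (1 - (norm \<alpha>)\<^sup>2) * ((norm (fps_nth u (Suc N)))\<^sup>2 - (norm (fps_nth u N))\<^sup>2)"
      using norm_blaschke_identity [of "fps_nth u (Suc N)" "fps_nth u N" \<alpha>]
      by (simp add: g h right_diff_distrib flip: mult.assoc)
    then show ?case
      using Suc.IH by (simp add: algebra_simps)
  qed
  have "(\<lambda>N. (\<Sum>k<Suc N. (norm (fps_nth h k))\<^sup>2) - (1 - (norm \<alpha>)\<^sup>2) * (norm (fps_nth u N))\<^sup>2)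
      \<longlonglongrightarrow> (\<Sum>k. (norm (fps_nth h k))\<^sup>2) - (1 - (norm \<alpha>)\<^sup>2) * 0"
    using hardy2_summable [OF h_mem] hardy2_summable [OF u_mem]
    by (intro tendsto_intros LIMSEQ_Suc [OF summable_LIMSEQ] summable_LIMSEQ_zero)
  then have "(\<lambda>N. \<Sum>k<Suc N. (norm (fps_nth g k))\<^sup>2) \<longlonglongrightarrow> (\<Sum>k. (norm (fps_nth h k))\<^sup>2)"
    by (simp only: telescope) simp
  then have "(\<lambda>k. (norm (fps_nth g k))\<^sup>2) sums (\<Sum>k. (norm (fps_nth h k))\<^sup>2)"
    unfolding sums_def by (rule LIMSEQ_imp_Suc)
  then show "h * blaschke_factor \<alpha> \<in> hardy2 \<and> hardy2_norm (h * blaschke_factor \<alpha>) = hardy2_norm h"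
    by (auto simp: hardy2_def hardy2_norm_def sums_iff simp flip: g_def)
qed

text \<open>This accounts for the conjugate in \<open>szego\<close>: pairing with the kernel
  evaluates h at \<alpha>, with the powers to the right of the coefficients.\<close>

lemma hardy2_inner_szego: "hardy2_inner h (szego \<alpha>) = (\<Sum>k. fps_nth h k * \<alpha> ^ k)"
  by (simp add: hardy2_inner_def qcnj_power)

text \<open>The inner product is linear for left constants only; this right constant can be pulled
  out because \<alpha> commutes with its own powers.\<close>

lemma hardy2_inner_szego_mult_const:
  assumes "norm \<alpha> < 1" "u \<in> hardy2"
  shows "hardy2_inner (u * fps_const \<alpha>) (szego \<alpha>) = hardy2_inner u (szego \<alpha>) * \<alpha>"
proof -
  have "hardy2_inner (u * fps_const \<alpha>) (szego \<alpha>) = (\<Sum>k. fps_nth u k * \<alpha> ^ k * \<alpha>)"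
    by (simp add: hardy2_inner_szego mult.assoc power_commutes)
  also have "\<dots> = (\<Sum>k. fps_nth u k * \<alpha> ^ k) * \<alpha>"
    using hardy2_inner_summable [OF assms(2) szego_mem [OF assms(1)]]
    by (intro suminf_mult2 [symmetric]) (simp add: qcnj_power)
  finally show ?thesis by (simp add: hardy2_inner_szego)
qed

text \<open>Here h b = z u - u \<alpha>. The adjoint of z acts on the kernel as left multiplication
  by the conjugate of \<alpha>, so both terms pair to [u, k] \<alpha> and cancel.\<close>

lemma hardy2_inner_mult_blaschke_szego:
  assumes "norm \<alpha> < 1" "h \<in> hardy2"
  shows "hardy2_inner (h * blaschke_factor \<alpha>) (szego \<alpha>) = 0"
proof -
  define u where "u = h * szego \<alpha>"
  have u: "u \<in> hardy2"
    unfolding u_def using assms by (rule mult_szego_mem)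
  have "h * blaschke_factor \<alpha> = fps_X * u - u * fps_const \<alpha>"
    by (simp add: u_def blaschke_factor_eq' fps_mult_fps_X_commute algebra_simps)
  moreover have "fps_shift 1 (szego \<alpha>) = fps_const (qcnj \<alpha>) * szego \<alpha>"
    by (simp add: fps_eq_iff)
  ultimately show ?thesis
    using assms u szego_mem [OF assms(1)]
    by (simp add: hardy2_inner_diff_left hardy2_fps_X_mult hardy2_mult_const
        hardy2_inner_shift_right hardy2_inner_const_right hardy2_inner_szego_mult_const)
qed

text \<open>The coefficients \<open>u\<^sub>k = \<Sum>\<^sub>j h\<^bsub>k+1+j\<^esub> \<alpha>\<^sup>j\<close> of the quotient solve \<open>h = u (z - \<alpha>)\<close>.\<close>

lemma blaschke_factor_divides:
  assumes \<alpha>: "norm \<alpha> < 1" and h: "h \<in> hardy2" and zero: "hardy2_inner h (szego \<alpha>) = 0"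
  shows "\<exists>h'\<in>hardy2. h = h' * blaschke_factor \<alpha>"
proof -
  \<comment> \<open>The index is shifted by one against the quotient, so that \<open>U 0\<close> is
    the pairing with the kernel, which vanishes by hypothesis.\<close>
  define U where "U k = (\<Sum>j. fps_nth h (k + j) * \<alpha> ^ j)" for k
  obtain M where M: "\<And>k. norm (fps_nth h k) \<le> M"
  proof -
    have "Bseq (\<lambda>k. (norm (fps_nth h k))\<^sup>2)"
      using summable_LIMSEQ_zero [OF hardy2_summable [OF h]] by (intro convergent_imp_Bseq convergentI)
    then obtain K where "\<And>k. (norm (fps_nth h k))\<^sup>2 \<le> K"
      unfolding Bseq_def by auto
    then have "norm (fps_nth h k) \<le> sqrt K" for k
      using real_le_rsqrt by blast
    then show thesis by (rule that)
  qed
  have summ_norm: "summable (\<lambda>j. norm (fps_nth h (k + j) * \<alpha> ^ j))" for k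
  proof (rule summable_comparison_test)
    show "\<exists>N. \<forall>j\<ge>N. norm (norm (fps_nth h (k + j) * \<alpha> ^ j)) \<le> M * norm \<alpha> ^ j"
      using M by (auto simp: norm_mult norm_power intro!: mult_right_mono)
    show "summable (\<lambda>j. M * norm \<alpha> ^ j)"
      using \<alpha> by (intro summable_mult summable_geometric) simp
  qed
  then have summ: "summable (\<lambda>j. fps_nth h (k + j) * \<alpha> ^ j)" for k
    by (rule summable_norm_cancel)
  have rec: "U k = fps_nth h k + U (Suc k) * \<alpha>" for k
  proof -
    have "U k = fps_nth h k + (\<Sum>j. fps_nth h (Suc k + j) * \<alpha> ^ j * \<alpha>)"
      using suminf_split_head [OF summ, of k] by (simp add: U_def mult.assoc power_commutes)
    also have "(\<Sum>j. fps_nth h (Suc k + j) * \<alpha> ^ j * \<alpha>) = U (Suc k) * \<alpha>"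
      unfolding U_def using summ by (intro suminf_mult2 [symmetric])
    finally show ?thesis .
  qed
  have U0: "U 0 = 0"
    using zero by (simp add: U_def hardy2_inner_szego)
  \<comment> \<open>This a priori bound is what the backward recursion \<open>rec\<close> needs in
    order to give square summability.\<close>
  have bound: "norm (U k) \<le> M / (1 - norm \<alpha>)" for k
  proof -
    have "norm (U k) \<le> (\<Sum>j. norm (fps_nth h (k + j) * \<alpha> ^ j))"
      unfolding U_def by (rule summable_norm [OF summ_norm])
    also have "\<dots> \<le> (\<Sum>j. M * norm \<alpha> ^ j)"
      using M \<alpha> by (intro suminf_le summ_norm summable_mult summable_geometric)
        (auto simp: norm_mult norm_power intro!: mult_right_mono)
    also have "\<dots> = M / (1 - norm \<alpha>)"
      using \<alpha> by (simp add: suminf_mult suminf_geometric summable_geometric)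
    finally show ?thesis .
  qed
  have U_summable: "summable (\<lambda>k. (norm (U k))\<^sup>2)"
  proof (rule summable_if_contracting_backward)
    fix k
    show "(norm (U k))\<^sup>2 \<le> (M / (1 - norm \<alpha>))\<^sup>2"
      using bound by (intro power_mono) auto
    have "norm (U k) \<le> norm (fps_nth h k) + norm \<alpha> * norm (U (Suc k))"
      using norm_triangle_ineq [of "fps_nth h k" "U (Suc k) * \<alpha>"]
      by (simp add: rec [of k] norm_mult mult.commute)
    then have "(norm (U k))\<^sup>2 \<le> (norm (fps_nth h k) + norm \<alpha> * norm (U (Suc k)))\<^sup>2"
      by (intro power_mono) auto
    also have "\<dots> \<le> norm \<alpha> * (norm (U (Suc k)))\<^sup>2 + (norm (fps_nth h k))\<^sup>2 / (1 - norm \<alpha>)"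
      using \<alpha> by (intro power2_add_contracting) auto
    finally show "(norm (U k))\<^sup>2 \<le> norm \<alpha> * (norm (U (Suc k)))\<^sup>2 + (norm (fps_nth h k))\<^sup>2 / (1 - norm \<alpha>)" .
  next
    show "summable (\<lambda>k. (norm (fps_nth h k))\<^sup>2 / (1 - norm \<alpha>))"
      using h by (intro summable_divide hardy2_summable)
  qed (use \<alpha> in auto)
  define u where "u = Abs_fps (\<lambda>k. U (Suc k))"
  have u: "u \<in> hardy2"
    using U_summable summable_Suc_iff [of "\<lambda>k. (norm (U k))\<^sup>2"] by (simp add: hardy2_def u_def)
  have h_eq: "h = u * (fps_X - fps_const \<alpha>)"
  proof (rule fps_ext)
    fix k
    have "fps_nth h k = U k - U (Suc k) * \<alpha>"
      by (simp add: rec [of k])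
    then show "fps_nth h k = fps_nth (u * (fps_X - fps_const \<alpha>)) k"
      by (cases k) (simp_all add: u_def right_diff_distrib U0)
  qed
  \<comment> \<open>The linear factor is the inverse of the kernel, so it cancels the
    \<open>szego\<close> contained in the Blaschke factor.\<close>
  define h' where "h' = u * (1 - fps_X * fps_const (qcnj \<alpha>))"
  have "h' = u - fps_X * (u * fps_const (qcnj \<alpha>))"
    by (simp add: h'_def right_diff_distrib fps_mult_fps_X_commute mult.assoc)
  then have "h' \<in> hardy2"
    using u by (simp add: hardy2_diff hardy2_fps_X_mult hardy2_mult_const)
  moreover have "h = h' * blaschke_factor \<alpha>"
  proof -
    have "h' * blaschke_factor \<alpha> = u * ((1 - fps_X * fps_const (qcnj \<alpha>)) * szego \<alpha>) * (fps_X - fps_const \<alpha>)"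
      by (simp add: h'_def blaschke_factor_eq' mult.assoc)
    then show ?thesis by (simp add: mult_szego h_eq)
  qed
  ultimately show ?thesis by blast
qed

section \<open>Left dimension and eigenvectors of the backward shift\<close>

lemma left_spanI: "x = (\<Sum>b\<in>B. fps_const (c b) * b) \<Longrightarrow> x \<in> left_span B"
  by (auto simp: left_span_def)

lemma left_span_scale: "x \<in> left_span B \<Longrightarrow> fps_const c * x \<in> left_span B"
proof -
  assume "x \<in> left_span B"
  then obtain d where "x = (\<Sum>b\<in>B. fps_const (d b) * b)"
    by (auto simp: left_span_def)
  then have "fps_const c * x = (\<Sum>b\<in>B. fps_const (c * d b) * b)"
    by (simp add: sum_distrib_left flip: mult.assoc)
  then show ?thesis by (rule left_spanI)
qed

lemma left_span_add: "x \<in> left_span B \<Longrightarrow> y \<in> left_span B \<Longrightarrow> x + y \<in> left_span B"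
proof -
  assume "x \<in> left_span B" "y \<in> left_span B"
  then obtain c d where "x = (\<Sum>b\<in>B. fps_const (c b) * b)" "y = (\<Sum>b\<in>B. fps_const (d b) * b)"
    by (auto simp: left_span_def)
  then have "x + y = (\<Sum>b\<in>B. fps_const (c b + d b) * b)"
    by (simp add: sum.distrib distrib_right flip: fps_const_add)
  then show ?thesis by (rule left_spanI)
qed

lemma left_span_base:
  assumes "finite B" "b \<in> B"
  shows "b \<in> left_span B"
proof -
  have "b = (\<Sum>x\<in>B. fps_const (if x = b then 1 else 0) * x)"
    using assms sum.remove [of B b "\<lambda>x. fps_const (if x = b then 1 else 0) * x"] by simp
  then show ?thesis by (rule left_spanI)
qed

lemma left_independent_nonzero:
  assumes "left_independent B" "finite B"
  shows "0 \<notin> B"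
proof
  assume "0 \<in> B"
  have "(\<Sum>b\<in>B. fps_const (if b = 0 then 1 else 0) * b) = 0"
    by (intro sum.neutral) auto
  then show False
    using assms \<open>0 \<in> B\<close> unfolding left_independent_def
    by (auto dest!: spec [of _ "\<lambda>b. if b = 0 then 1 else 0"])
qed

lemma has_left_dim_0_iff: "has_left_dim V 0 \<longleftrightarrow> V = {0}"
  by (auto simp: has_left_dim_def left_span_def left_independent_def)

text \<open>Bases are sets, so an indexed family must first be seen to be injective: a repeated
  member would give a relation with coefficients 1 and -1.\<close>

lemma has_left_dim_family:
  fixes w :: "'i \<Rightarrow> quat fps"
  assumes "finite I" "card I = n"
    and indep: "\<And>c i. (\<Sum>i\<in>I. fps_const (c i) * w i) = 0 \<Longrightarrow> i \<in> I \<Longrightarrow> c i = 0"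
    and span: "V = {(\<Sum>i\<in>I. fps_const (c i) * w i) | c. True}"
  shows "has_left_dim V n"
proof -
  have inj: "inj_on w I"
  proof (rule inj_onI, rule ccontr)
    fix i j assume ij: "i \<in> I" "j \<in> I" "w i = w j" "i \<noteq> j"
    let ?c = "\<lambda>k. if k = i then 1 else if k = j then -1 else (0 :: quat)"
    have "(\<Sum>k\<in>I. fps_const (?c k) * w k) = (\<Sum>k\<in>I. (if k = i then w i else 0) + (if k = j then - w j else 0))"
      using ij by (intro sum.cong) (auto simp flip: fps_const_neg)
    also have "\<dots> = 0"
      using ij assms(1) by (simp add: sum.distrib)
    finally show False
      using indep [of ?c i] ij by simp
  qed
  have sum_eq: "(\<Sum>b\<in>w ` I. fps_const (c b) * b) = (\<Sum>i\<in>I. fps_const (c (w i)) * w i)" for c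
    by (simp add: sum.reindex [OF inj])
  have "left_independent (w ` I)"
    unfolding left_independent_def sum_eq by (auto dest: indep)
  moreover have "left_span (w ` I) = V"
  proof
    show "left_span (w ` I) \<subseteq> V"
    proof
      fix x assume "x \<in> left_span (w ` I)"
      then obtain c where "x = (\<Sum>i\<in>I. fps_const (c (w i)) * w i)"
        unfolding left_span_def sum_eq by blast
      then show "x \<in> V"
        unfolding span by (intro CollectI exI [of _ "\<lambda>i. c (w i)"]) simp
    qed
    show "V \<subseteq> left_span (w ` I)"
    proof
      fix x assume "x \<in> V"
      then obtain c where "x = (\<Sum>i\<in>I. fps_const (c i) * w i)"
        by (auto simp: span)
      also have "\<dots> = (\<Sum>b\<in>w ` I. fps_const (c (the_inv_into I w b)) * b)"
        unfolding sum_eq by (intro sum.cong) (simp_all add: the_inv_into_f_f inj)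
      finally show "x \<in> left_span (w ` I)"
        by (rule left_spanI)
    qed
  qed
  ultimately show ?thesis
    using assms(1,2) card_image [OF inj] unfolding has_left_dim_def by blast
qed

text \<open>A relation with nonzero coefficient at e could be solved for e by left division, which
  would put e in V.\<close>

lemma has_left_dim_extend:
  assumes "has_left_dim V n" "e \<notin> V"
  shows "has_left_dim {fps_const c * e + v | c v. v \<in> V} (Suc n)"
proof -
  obtain B where B: "finite B" "card B = n" "left_independent B" "left_span B = V"
    using assms(1) unfolding has_left_dim_def by blast
  have "e \<notin> B"
    using left_span_base [OF B(1)] B(4) assms(2) by blast
  show ?thesis
  proof (rule has_left_dim_family [where I = "insert e B" and w = "\<lambda>b. b"])
    show "finite (insert e B)" "card (insert e B) = Suc n"
      using B \<open>e \<notin> B\<close> by auto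
  next
    fix c b assume "(\<Sum>b\<in>insert e B. fps_const (c b) * b) = 0" and b: "b \<in> insert e B"
    then have *: "fps_const (c e) * e + (\<Sum>b\<in>B. fps_const (c b) * b) = 0"
      using B(1) \<open>e \<notin> B\<close> by simp
    have "c e = 0"
    proof (rule ccontr)
      assume "c e \<noteq> 0"
      have "e = fps_const (inverse (c e)) * (fps_const (c e) * e)"
        using \<open>c e \<noteq> 0\<close> by (simp flip: mult.assoc)
      also have "fps_const (c e) * e = fps_const (-1) * (\<Sum>b\<in>B. fps_const (c b) * b)"
        using * by (simp add: eq_neg_iff_add_eq_0 flip: fps_const_neg)
      finally have "e \<in> left_span B"
        by (metis (mono_tags, lifting) left_span_def left_span_scale mem_Collect_eq)
      then show False using assms(2) B(4) by simp
    qed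
    moreover have "\<forall>b\<in>B. c b = 0"
      using * B(3) \<open>c e = 0\<close> unfolding left_independent_def by simp
    ultimately show "c b = 0" using b by auto
  next
    show "{fps_const c * e + v | c v. v \<in> V} = {(\<Sum>b\<in>insert e B. fps_const (c b) * b) | c. True}"
    proof (intro equalityI subsetI)
      fix x assume "x \<in> {fps_const c * e + v | c v. v \<in> V}"
      then obtain a c where "x = fps_const a * e + (\<Sum>b\<in>B. fps_const (c b) * b)"
        by (auto simp: left_span_def simp flip: B(4))
      also have "(\<Sum>b\<in>B. fps_const (c b) * b) = (\<Sum>b\<in>B. fps_const ((c(e := a)) b) * b)"
        using \<open>e \<notin> B\<close> by (intro sum.cong) auto
      finally have "x = (\<Sum>b\<in>insert e B. fps_const ((c(e := a)) b) * b)"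
        using B(1) \<open>e \<notin> B\<close> by simp
      then show "x \<in> {(\<Sum>b\<in>insert e B. fps_const (c b) * b) | c. True}" by blast
    next
      fix x assume "x \<in> {(\<Sum>b\<in>insert e B. fps_const (c b) * b) | c. True}"
      then show "x \<in> {fps_const c * e + v | c v. v \<in> V}"
        using B(1) \<open>e \<notin> B\<close> by (auto simp: left_span_def simp flip: B(4))
    qed
  qed
qed

text \<open>Elimination with a pivot: a basis vector b0 with \<open>\<phi> b0\<close> nonzero is
  dropped, and every other basis vector is moved into the kernel by subtracting a left multiple of
  b0.\<close>

lemma has_left_dim_kernel:
  fixes \<phi> :: "quat fps \<Rightarrow> quat"
  assumes "has_left_dim V (Suc n)"
    and add: "\<And>x y. x \<in> V \<Longrightarrow> y \<in> V \<Longrightarrow> \<phi> (x + y) = \<phi> x + \<phi> y"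
    and scale: "\<And>c x. x \<in> V \<Longrightarrow> \<phi> (fps_const c * x) = c * \<phi> x"
    and e: "e \<in> V" "\<phi> e \<noteq> 0"
  shows "has_left_dim {x \<in> V. \<phi> x = 0} n"
proof -
  obtain B where B: "finite B" "card B = Suc n" "left_independent B" "left_span B = V"
    using assms(1) unfolding has_left_dim_def by blast
  have zero: "0 \<in> V"
    using e(1) left_span_scale [of e B 0] by (simp add: B(4))
  have \<phi>0: "\<phi> 0 = 0"
    using add [OF zero zero] by simp
  have \<phi>_sum: "(\<Sum>b\<in>A. fps_const (c b) * b) \<in> V \<and>
      \<phi> (\<Sum>b\<in>A. fps_const (c b) * b) = (\<Sum>b\<in>A. c b * \<phi> b)" if "A \<subseteq> B" for A c
    using finite_subset [OF that B(1)] that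
  proof (induction A rule: finite_induct)
    case empty
    then show ?case using zero \<phi>0 by simp
  next
    case (insert b A)
    then have "b \<in> V" using left_span_base [OF B(1)] B(4) by blast
    then show ?case
      using insert left_span_scale [of b B] left_span_add [of _ B] by (simp add: B(4) add scale)
  qed
  obtain b0 where b0: "b0 \<in> B" "\<phi> b0 \<noteq> 0"
  proof (rule ccontr)
    assume "\<not> thesis"
    then have "\<forall>b\<in>B. \<phi> b = 0" using that by blast
    moreover obtain c where "e = (\<Sum>b\<in>B. fps_const (c b) * b)"
      using e(1) B(4) unfolding left_span_def by blast
    ultimately have "\<phi> e = 0" using \<phi>_sum [of B c] by simp
    then show False using e(2) by simp
  qed
  \<comment> \<open>Chosen so that \<open>\<phi> b = t b * \<phi> b0\<close>, which makes \<phi>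
    vanish on \<open>w b\<close>.\<close>
  define t where "t b = \<phi> b * inverse (\<phi> b0)" for b
  define w where "w b = b - fps_const (t b) * b0" for b
  let ?I = "B - {b0}"
  \<comment> \<open>The coefficients over B of the combination of the \<open>w b\<close> with
    coefficients c: the entry at b0 collects all corrections.\<close>
  define ext where "ext c = c(b0 := - (\<Sum>b\<in>?I. c b * t b))" for c :: "quat fps \<Rightarrow> quat"
  have sum_w: "(\<Sum>b\<in>?I. fps_const (c b) * w b) = (\<Sum>b\<in>B. fps_const (ext c b) * b)" for c
  proof -
    have "(\<Sum>b\<in>?I. fps_const (c b) * w b) =
        (\<Sum>b\<in>?I. fps_const (c b) * b) - (\<Sum>b\<in>?I. fps_const (c b * t b)) * b0"
      by (simp add: w_def right_diff_distrib sum_subtractf sum_distrib_right flip: mult.assoc)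
    also have "(\<Sum>b\<in>?I. fps_const (c b * t b)) = - fps_const (ext c b0)"
      by (rule fps_ext) (simp add: ext_def fps_sum_nth sum_negf)
    also have "(\<Sum>b\<in>?I. fps_const (c b) * b) = (\<Sum>b\<in>?I. fps_const (ext c b) * b)"
      by (intro sum.cong) (auto simp: ext_def)
    finally show ?thesis
      using sum.remove [OF B(1) b0(1), of "\<lambda>b. fps_const (ext c b) * b"]
      by (simp add: add.commute del: fps_const_neg)
  qed
  have \<phi>_ext: "(\<Sum>b\<in>B. ext c b * \<phi> b) = 0" for c
  proof -
    have "(\<Sum>b\<in>?I. c b * t b) * \<phi> b0 = (\<Sum>b\<in>?I. c b * \<phi> b)"
      using b0(2) by (simp add: t_def sum_distrib_right mult.assoc)
    also have "\<dots> = (\<Sum>b\<in>?I. ext c b * \<phi> b)"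
      by (intro sum.cong) (auto simp: ext_def)
    finally show ?thesis
      using sum.remove [OF B(1) b0(1), of "\<lambda>b. ext c b * \<phi> b"] by (simp add: ext_def)
  qed
  show ?thesis
  proof (rule has_left_dim_family [where I = ?I and w = w])
    show "finite ?I" "card ?I = n"
      using B b0 by auto
  next
    fix c b assume "(\<Sum>b\<in>?I. fps_const (c b) * w b) = 0" and b: "b \<in> ?I"
    then have "ext c b = 0"
      using B(3) unfolding left_independent_def sum_w by blast
    then show "c b = 0" using b by (simp add: ext_def)
  next
    show "{x \<in> V. \<phi> x = 0} = {(\<Sum>b\<in>?I. fps_const (c b) * w b) | c. True}"
    proof (intro equalityI subsetI)
      fix x assume "x \<in> {x \<in> V. \<phi> x = 0}"
      then obtain c where x: "x = (\<Sum>b\<in>B. fps_const (c b) * b)" and "\<phi> x = 0"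
        using B(4) unfolding left_span_def by blast
      then have "c b0 * \<phi> b0 + (\<Sum>b\<in>?I. c b * \<phi> b) = 0"
        using \<phi>_sum [of B c] sum.remove [OF B(1) b0(1), of "\<lambda>b. c b * \<phi> b"] by simp
      then have "c b0 * \<phi> b0 = - (\<Sum>b\<in>?I. c b * \<phi> b)"
        by (simp add: eq_neg_iff_add_eq_0)
      then have "c b0 * \<phi> b0 * inverse (\<phi> b0) = - (\<Sum>b\<in>?I. c b * \<phi> b) * inverse (\<phi> b0)"
        by (rule arg_cong)
      then have "c b0 = - (\<Sum>b\<in>?I. c b * t b)"
        using b0(2) by (simp add: t_def sum_distrib_right mult.assoc)
      \<comment> \<open>On the kernel the coefficient at the pivot is forced to be the one that
        \<open>ext\<close> prescribes.\<close>
      then have "ext c = c" by (auto simp: ext_def)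
      then have "x = (\<Sum>b\<in>?I. fps_const (c b) * w b)" by (simp add: sum_w x)
      then show "x \<in> {(\<Sum>b\<in>?I. fps_const (c b) * w b) | c. True}" by blast
    next
      fix x assume "x \<in> {(\<Sum>b\<in>?I. fps_const (c b) * w b) | c. True}"
      then show "x \<in> {x \<in> V. \<phi> x = 0}"
        using \<phi>_sum [of B] \<phi>_ext by (auto simp: sum_w)
    qed
  qed
qed

text \<open>Right multiplication by a nonzero series is left linear and injective, so the preimages
  of a basis form a basis.\<close>

lemma has_left_dim_mult_right_cancel:
  assumes dim: "has_left_dim ((\<lambda>x. x * g) ` V) n" and g: "g \<noteq> 0"
  shows "has_left_dim V n"
proof -
  obtain B where B: "finite B" "card B = n" "left_independent B" "left_span B = (\<lambda>x. x * g) ` V"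
    using dim unfolding has_left_dim_def by blast
  have "\<forall>b\<in>B. \<exists>x. b = x * g"
    using left_span_base [OF B(1)] B(4) by blast
  then obtain w where w: "\<And>b. b \<in> B \<Longrightarrow> w b * g = b"
    by metis
  have sum_w: "(\<Sum>b\<in>B. fps_const (c b) * w b) * g = (\<Sum>b\<in>B. fps_const (c b) * b)" for c
    by (simp add: sum_distrib_right mult.assoc w)
  show ?thesis
  proof (rule has_left_dim_family [where I = B and w = w])
    fix c b assume "(\<Sum>b\<in>B. fps_const (c b) * w b) = 0" "b \<in> B"
    then show "c b = 0"
      using B(3) sum_w [of c] by (simp add: left_independent_def)
  next
    show "V = {(\<Sum>b\<in>B. fps_const (c b) * w b) | c. True}"
    proof (intro equalityI subsetI)
      fix x assume "x \<in> V"
      then obtain c where "x * g = (\<Sum>b\<in>B. fps_const (c b) * b)"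
        using B(4) unfolding left_span_def by blast
      then show "x \<in> {(\<Sum>b\<in>B. fps_const (c b) * w b) | c. True}"
        using g by (auto simp flip: sum_w)
    next
      fix x assume "x \<in> {(\<Sum>b\<in>B. fps_const (c b) * w b) | c. True}"
      then have "x * g \<in> left_span B"
        by (auto simp: sum_w left_span_def)
      then show "x \<in> V" using B(4) g by auto
    qed
  qed (use B in auto)
qed

section \<open>Complex scalars and eigenvectors of the backward shift\<close>

definition quat_of_complex :: "complex \<Rightarrow> quat" where
  "quat_of_complex z = Quat (Re z) (Im z) 0 0"

lemma quat_of_complex_simps [simp]:
  "quat_of_complex 0 = 0" "quat_of_complex 1 = 1"
  "quat_of_complex (z + w) = quat_of_complex z + quat_of_complex w"
  "quat_of_complex (- z) = - quat_of_complex z"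
  "quat_of_complex (z * w) = quat_of_complex z * quat_of_complex w"
  "quat_of_complex z = 0 \<longleftrightarrow> z = 0"
  by (simp_all add: quat_of_complex_def quat_eq_iff complex_eq_iff)

lemma quat_of_complex_commute: "quat_of_complex z * quat_of_complex w = quat_of_complex w * quat_of_complex z"
  by (metis mult.commute quat_of_complex_simps(5))

text \<open>Commuting scalars allow both a dimension count and polynomials in the shift whose roots
  exist.\<close>

interpretation complex_fps: vector_space "\<lambda>z x. fps_const (quat_of_complex z) * x"
  by unfold_locales
    (simp_all add: distrib_left distrib_right flip: mult.assoc fps_const_add)

text \<open>\<open>poly_shift p\<close> is \<open>p\<close> evaluated at the backward shift, the complex coefficients
  acting by left multiplication.\<close>

definition poly_shift :: "complex poly \<Rightarrow> quat fps \<Rightarrow> quat fps" where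
  "poly_shift p = fold_coeffs (\<lambda>a F x. fps_const (quat_of_complex a) * x + F (fps_shift 1 x)) p (\<lambda>x. 0)"

lemma poly_shift_0 [simp]: "poly_shift 0 x = 0"
  by (simp add: poly_shift_def)

lemma poly_shift_pCons [simp]:
  "poly_shift (pCons a p) x = fps_const (quat_of_complex a) * x + poly_shift p (fps_shift 1 x)"
  by (cases "p = 0 \<and> a = 0") (auto simp: poly_shift_def)

lemma poly_shift_add: "poly_shift (p + q) x = poly_shift p x + poly_shift q x"
  by (induction p q arbitrary: x rule: poly_induct2) (simp_all add: algebra_simps flip: fps_const_add)

lemma fps_shift_const_mult: "fps_shift n (fps_const c * x) = fps_const c * fps_shift n (x :: quat fps)"
  by (rule fps_ext) simp

lemma poly_shift_smult: "poly_shift (smult c p) x = poly_shift p (fps_const (quat_of_complex c) * x)"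
  by (induction p arbitrary: x)
    (simp_all add: fps_shift_const_mult quat_of_complex_commute flip: mult.assoc)

lemma poly_shift_add_right: "poly_shift p (x + y) = poly_shift p x + poly_shift p y"
  by (induction p arbitrary: x y) (simp_all add: fps_shift_add algebra_simps)

lemma poly_shift_sum: "poly_shift (sum P I) x = (\<Sum>i\<in>I. poly_shift (P i) x)"
  by (induction I rule: infinite_finite_induct) (simp_all add: poly_shift_add)

lemma poly_shift_monom: "poly_shift (monom a n) x = fps_const (quat_of_complex a) * fps_shift n x"
  by (induction n arbitrary: x)
    (simp_all add: monom_0 monom_Suc flip: fps_shift_fps_shift)

text \<open>Split off a root a of p and apply the shift minus a to x. Either the result is 0 and x
  is an eigenvector, or it is a nonzero vector of V killed by the quotient, which has smaller
  degree. A nonzero constant polynomial cannot kill x.\<close>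

lemma shift_eigenvector_of_poly_shift_eq_0:
  assumes shift: "\<And>x. x \<in> V \<Longrightarrow> fps_shift 1 x \<in> V"
    and add: "\<And>x y. x \<in> V \<Longrightarrow> y \<in> V \<Longrightarrow> x + y \<in> V"
    and scale: "\<And>c x. x \<in> V \<Longrightarrow> fps_const c * x \<in> V"
    and "p \<noteq> 0" "x \<in> V" "x \<noteq> 0" "poly_shift p x = 0"
  shows "\<exists>y\<in>V. y \<noteq> 0 \<and> (\<exists>c. fps_shift 1 y = fps_const c * y)"
  using assms(4-)
proof (induction "degree p" arbitrary: p x)
  case 0
  then obtain a where "p = [:a:]" by (auto elim: degree_eq_zeroE)
  then show ?case using 0 by simp
next
  case (Suc n)
  have "\<not> constant (poly p)"
    using Suc.hyps(2) by (simp add: constant_degree)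
  then obtain a where "poly p a = 0"
    using fundamental_theorem_of_algebra by blast
  then obtain q where p: "p = [:- a, 1:] * q"
    using poly_eq_0_iff_dvd by (metis dvdE)
  then have q: "q \<noteq> 0"
    using Suc.prems(1) by auto
  have "degree q = n"
    using Suc.hyps(2) q unfolding p by (subst (asm) degree_mult_eq) auto
  define y where "y = fps_const (quat_of_complex (- a)) * x + fps_shift 1 x"
  have "poly_shift p x = poly_shift q y"
    by (simp only: p y_def mult_pCons_left poly_shift_add poly_shift_smult poly_shift_add_right) simp
  moreover have "y \<in> V"
    unfolding y_def using Suc.prems by (intro add scale shift)
  ultimately show ?case
  proof (cases "y = 0")
    case True
    then have "fps_shift 1 x = fps_const (quat_of_complex a) * x"
      by (simp add: y_def eq_neg_iff_add_eq_0 flip: fps_const_neg)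
    then show ?thesis using Suc.prems by blast
  next
    case False
    then show ?thesis
      using Suc.hyps(1) [of q y] q \<open>degree q = n\<close> \<open>y \<in> V\<close> \<open>poly_shift p x = poly_shift q y\<close> Suc.prems by simp
  qed
qed

text \<open>Every quaternion is z + w j with z, w complex and j = \<open>Quat 0 0 1 0\<close>, so
  each b contributes the two generators b and j b.\<close>

lemma left_span_subset_complex_span:
  assumes "finite B"
  shows "left_span B \<subseteq> complex_fps.span (B \<union> (\<lambda>b. fps_const (Quat 0 0 1 0) * b) ` B)"
proof
  let ?T = "B \<union> (\<lambda>b. fps_const (Quat 0 0 1 0) * b) ` B"
  fix x assume "x \<in> left_span B"
  then obtain c where x: "x = (\<Sum>b\<in>B. fps_const (c b) * b)"
    by (auto simp: left_span_def)
  have "fps_const a * b \<in> complex_fps.span ?T" if "b \<in> B" for a b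
  proof -
    have "a = quat_of_complex (Complex (q0 a) (q1 a)) + quat_of_complex (Complex (q2 a) (q3 a)) * Quat 0 0 1 0"
      by (simp add: quat_eq_iff quat_of_complex_def)
    then have "fps_const a * b = fps_const (quat_of_complex (Complex (q0 a) (q1 a))) * b +
        fps_const (quat_of_complex (Complex (q2 a) (q3 a))) * (fps_const (Quat 0 0 1 0) * b)"
      by (metis distrib_right fps_const_add fps_const_mult mult.assoc)
    also have "\<dots> \<in> complex_fps.span ?T"
      using that by (intro complex_fps.span_add complex_fps.span_scale complex_fps.span_base) auto
    finally show ?thesis .
  qed
  then show "x \<in> complex_fps.span ?T"
    unfolding x by (intro complex_fps.span_sum)
qed

text \<open>Among \<open>card T + 1\<close> iterates of the shift on x there is a complex linear
  relation, and its coefficients are those of p.\<close>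

lemma shift_annihilating_polynomial:
  assumes "finite T" and span: "\<And>i. fps_shift i x \<in> complex_fps.span T"
  shows "\<exists>p. p \<noteq> 0 \<and> poly_shift p x = 0"
proof (cases "inj_on (\<lambda>i. fps_shift i x) {..card T}")
  \<comment> \<open>Coinciding iterates collapse in the set of iterates, so they are treated apart:
    a difference of two monomials then serves.\<close>
  case False
  then obtain i j where ij: "fps_shift i x = fps_shift j x" "i \<noteq> j"
    by (auto simp: inj_on_def)
  let ?p = "monom 1 i + monom (- 1) j :: complex poly"
  have "coeff ?p i \<noteq> 0" using ij by simp
  then have "?p \<noteq> 0" by force
  moreover have "poly_shift ?p x = 0"
    using ij by (simp add: poly_shift_add poly_shift_monom flip: fps_const_neg)
  ultimately show ?thesis by blast
next
  case True
  let ?S = "(\<lambda>i. fps_shift i x) ` {..card T}"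
  have "card ?S = Suc (card T)"
    using card_image [OF True] by simp
  then have "complex_fps.dependent ?S"
    using complex_fps.independent_span_bound [OF assms(1), of ?S] span by auto
  then obtain u v where u: "(\<Sum>v\<in>?S. fps_const (quat_of_complex (u v)) * v) = 0" and "v \<in> ?S" "u v \<noteq> 0"
    using complex_fps.dependent_finite [of ?S] by auto
  then obtain i where i: "i \<le> card T" "u (fps_shift i x) \<noteq> 0" by auto
  let ?p = "\<Sum>i\<le>card T. monom (u (fps_shift i x)) i"
  have "coeff ?p i \<noteq> 0"
    using i by (simp add: coeff_sum)
  then have "?p \<noteq> 0" by force
  moreover have "poly_shift ?p x = 0"
    using u by (simp add: poly_shift_sum poly_shift_monom sum.reindex [OF True])
  ultimately show ?thesis by blast
qed

text \<open>All iterates of the shift on a nonzero vector stay in V, which lies in the complex span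
  of a finite set; hence some polynomial in the shift kills that vector.\<close>

lemma shift_eigenvector:
  assumes "has_left_dim V (Suc n)" and shift: "\<And>x. x \<in> V \<Longrightarrow> fps_shift 1 x \<in> V"
  shows "\<exists>y\<in>V. y \<noteq> 0 \<and> (\<exists>c. fps_shift 1 y = fps_const c * y)"
proof -
  obtain B where B: "finite B" "card B = Suc n" "left_independent B" "left_span B = V"
    using assms(1) unfolding has_left_dim_def by blast
  then obtain x where "x \<in> B" by (metis card.empty equals0I nat.distinct(1))
  then have x: "x \<in> V" "x \<noteq> 0"
    using left_span_base B left_independent_nonzero by blast+
  have "fps_shift i x \<in> V" for i
  proof (induction i)
    case (Suc i)
    then show ?case
      using shift [OF Suc] fps_shift_fps_shift [of 1 i x] by simp
  qed (use x in simp)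
  then have span: "fps_shift i x \<in> complex_fps.span (B \<union> (\<lambda>b. fps_const (Quat 0 0 1 0) * b) ` B)" for i
    using left_span_subset_complex_span [OF B(1)] B(4) by (meson subsetD)
  have "\<exists>p. p \<noteq> 0 \<and> poly_shift p x = 0"
    by (rule shift_annihilating_polynomial [OF _ span]) (use B(1) in simp)
  then obtain p where p: "p \<noteq> 0" "poly_shift p x = 0"
    by blast
  show ?thesis
    by (rule shift_eigenvector_of_poly_shift_eq_0 [OF shift _ _ p(1) x p(2)])
      (simp_all add: left_span_add left_span_scale flip: B(4))
qed

section \<open>Codimension of the range of an isometric multiplier\<close>

lemma orth_range_iff:
  "x \<in> hardy2_orth ((\<lambda>h. h * f) ` hardy2) \<longleftrightarrow> x \<in> hardy2 \<and> (\<forall>h\<in>hardy2. hardy2_inner (h * f) x = 0)"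
  by (auto simp: hardy2_orth_def)

lemma shift_orth_range:
  assumes "isometric_multiplier f" "x \<in> hardy2_orth ((\<lambda>h. h * f) ` hardy2)"
  shows "fps_shift 1 x \<in> hardy2_orth ((\<lambda>h. h * f) ` hardy2)"
  using assms hardy2_fps_X_mult
  by (auto simp: orth_range_iff hardy2_shift isometric_multiplier_mem
      simp flip: hardy2_inner_shift_right mult.assoc simp del: One_nat_def)

text \<open>By adjointness and isometry the pairing equals [z h f, f] = [z h, 1], the constant
  coefficient of z h, which is 0.\<close>

lemma shift_self_mem_orth_range:
  assumes f: "isometric_multiplier f"
  shows "fps_shift 1 f \<in> hardy2_orth ((\<lambda>h. h * f) ` hardy2)"
  unfolding orth_range_iff
proof (intro conjI ballI)
  show "fps_shift 1 f \<in> hardy2"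
    by (intro hardy2_shift isometric_multiplier_self_mem f)
  fix h assume h: "h \<in> hardy2"
  have "hardy2_inner (h * f) (fps_shift 1 f) = hardy2_inner (fps_X * h * f) (1 * f)"
    using h f by (simp add: isometric_multiplier_mem isometric_multiplier_self_mem mult.assoc
        flip: hardy2_inner_shift_right del: One_nat_def)
  also have "\<dots> = hardy2_inner (fps_X * h) 1"
    using h f by (intro isometric_multiplier_inner hardy2_fps_X_mult) auto
  also have "\<dots> = 0"
    using h by (subst hardy2_inner_shift_right) (auto simp: fps_shift_one)
  finally show "hardy2_inner (h * f) (fps_shift 1 f) = 0" .
qed

lemma hardy2_norm_const: "hardy2_norm (fps_const c) = norm c"
proof -
  have "(\<Sum>k. (norm (fps_nth (fps_const c) k))\<^sup>2) = (\<Sum>k\<in>{0}. (norm (fps_nth (fps_const c) k))\<^sup>2)"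
    by (intro suminf_finite) auto
  then show ?thesis by (simp add: hardy2_norm_def)
qed

text \<open>H^2 is the orthogonal sum of H^2 b and the line of the kernel k. Multiplying by the
  isometric g splits H^2 g into H^2 b g and the line of k g, so the complement of H^2 b g gains just
  that line.\<close>

lemma orth_range_blaschke_mult:
  assumes \<alpha>: "norm \<alpha> < 1" and g: "isometric_multiplier g"
  shows "hardy2_orth ((\<lambda>h. h * (blaschke_factor \<alpha> * g)) ` hardy2) =
    {fps_const c * (szego \<alpha> * g) + v | c v. v \<in> hardy2_orth ((\<lambda>h. h * g) ` hardy2)}" (is "?L = ?R")
    and "szego \<alpha> * g \<notin> hardy2_orth ((\<lambda>h. h * g) ` hardy2)"
proof -
  let ?b = "blaschke_factor \<alpha>" and ?k = "szego \<alpha>"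
  define N where "N = hardy2_inner ?k ?k"
  have k: "?k \<in> hardy2" and kg: "?k * g \<in> hardy2"
    using szego_mem [OF \<alpha>] isometric_multiplier_mem [OF g] by auto
  have N: "N \<noteq> 0"
    using hardy2_inner_self_eq_0 [OF k] szego_nonzero unfolding N_def by blast
  have N_g: "hardy2_inner (?k * g) (?k * g) = N"
    unfolding N_def by (rule isometric_multiplier_inner [OF g k k])
  have b_mem: "h * ?b \<in> hardy2" if "h \<in> hardy2" for h
    using isometric_multiplier_mem [OF isometric_multiplier_blaschke_factor [OF \<alpha>] that] .
  have g_mem: "h * g \<in> hardy2" if "h \<in> hardy2" for h
    using isometric_multiplier_mem [OF g that] .
  have bg_k: "hardy2_inner (h * ?b * g) (?k * g) = 0" if "h \<in> hardy2" for h
    using isometric_multiplier_inner [OF g b_mem [OF that] k] hardy2_inner_mult_blaschke_szego [OF \<alpha> that]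
    by simp
  show "?k * g \<notin> hardy2_orth ((\<lambda>h. h * g) ` hardy2)"
    using N N_g k by (auto simp: orth_range_iff)
  show "?L = ?R"
  proof (intro equalityI subsetI)
    fix x assume "x \<in> ?R"
    then obtain c v where x: "x = fps_const c * (?k * g) + v" and v: "v \<in> hardy2_orth ((\<lambda>h. h * g) ` hardy2)"
      by blast
    then have v': "v \<in> hardy2" "\<And>h. h \<in> hardy2 \<Longrightarrow> hardy2_inner (h * g) v = 0"
      by (auto simp: orth_range_iff)
    show "x \<in> ?L"
      unfolding orth_range_iff
    proof (intro conjI ballI)
      show "x \<in> hardy2"
        using kg v' by (simp add: x hardy2_add hardy2_const_mult)
      fix h assume h: "h \<in> hardy2"
      have "hardy2_inner (h * ?b * g) x = 0"
        using h kg v' bg_k [OF h] b_mem g_mem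
        by (simp add: x hardy2_inner_add_right hardy2_const_mult hardy2_inner_const_right)
      then show "hardy2_inner (h * (?b * g)) x = 0"
        by (simp add: mult.assoc)
    qed
  next
    fix x assume "x \<in> ?L"
    then have x: "x \<in> hardy2" "\<And>h. h \<in> hardy2 \<Longrightarrow> hardy2_inner (h * ?b * g) x = 0"
      by (auto simp: orth_range_iff mult.assoc)
    \<comment> \<open>The coefficient of the orthogonal projection of x onto the line of k g; y is
      what remains.\<close>
    define c where "c = hardy2_inner x (?k * g) * inverse N"
    define y where "y = x - fps_const c * (?k * g)"
    have y: "y \<in> hardy2"
      using x kg by (simp add: y_def hardy2_diff hardy2_const_mult)
    have "hardy2_inner y (?k * g) = 0"
      using x kg N by (simp add: y_def hardy2_inner_diff_left hardy2_const_mult hardy2_inner_const_left N_g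
          c_def mult.assoc)
    then have k_y: "hardy2_inner (?k * g) y = 0"
      using hardy2_inner_commute [OF kg y] by simp
    have "hardy2_inner (h * g) y = 0" if h: "h \<in> hardy2" for h
    proof -
      \<comment> \<open>Removing from h its projection onto k leaves a series orthogonal to k, hence
        divisible by the Blaschke factor.\<close>
      define d where "d = hardy2_inner h ?k * inverse N"
      have dk: "fps_const d * ?k \<in> hardy2"
        using k by (rule hardy2_const_mult)
      have "hardy2_inner (h - fps_const d * ?k) ?k = 0"
        using h k dk N by (simp add: hardy2_inner_diff_left hardy2_inner_const_left d_def mult.assoc flip: N_def)
      then obtain h' where h': "h' \<in> hardy2" "h - fps_const d * ?k = h' * ?b"
        using blaschke_factor_divides [OF \<alpha> hardy2_diff [OF h dk]] by blast
      then have "h = h' * ?b + fps_const d * ?k"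
        by (simp add: algebra_simps)
      then have "h * g = h' * ?b * g + fps_const d * (?k * g)"
        by (simp add: distrib_right mult.assoc)
      then have "hardy2_inner (h * g) y = hardy2_inner (h' * ?b * g) y + d * hardy2_inner (?k * g) y"
        using h' kg y b_mem g_mem
        by (simp add: hardy2_inner_add_left hardy2_const_mult hardy2_inner_const_left)
      also have "hardy2_inner (h' * ?b * g) y = 0"
        using x h' kg b_mem g_mem bg_k
        by (simp add: y_def hardy2_inner_diff_right hardy2_const_mult hardy2_inner_const_right)
      finally show ?thesis by (simp add: k_y)
    qed
    then have "y \<in> hardy2_orth ((\<lambda>h. h * g) ` hardy2)"
      using y by (simp add: orth_range_iff)
    moreover have "x = fps_const c * (?k * g) + y"
      by (simp add: y_def)
    ultimately show "x \<in> ?R" by blast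
  qed
qed

section \<open>The two directions of the characterization\<close>

lemma const_mult_qcnj:
  assumes "norm \<phi> = 1"
  shows "\<phi> * qcnj \<phi> = 1" "qcnj \<phi> * \<phi> = 1"
  using assms by (simp_all add: quat_mult_qcnj quat_qcnj_mult)

text \<open>The constant is invertible, so x itself lies in the range and is orthogonal to
  itself.\<close>

lemma orth_range_const:
  assumes "norm \<phi> = 1"
  shows "hardy2_orth ((\<lambda>h. h * fps_const \<phi>) ` hardy2) = {0}"
proof -
  have "x = 0" if "x \<in> hardy2_orth ((\<lambda>h. h * fps_const \<phi>) ` hardy2)" for x
  proof -
    have x: "x \<in> hardy2" using that by (simp add: orth_range_iff)
    have "hardy2_inner (x * fps_const (qcnj \<phi>) * fps_const \<phi>) x = 0"
      using that hardy2_mult_const [OF x] by (simp only: orth_range_iff)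
    then show ?thesis
      using hardy2_inner_self_eq_0 [OF x] by (simp add: mult.assoc const_mult_qcnj assms)
  qed
  then show ?thesis by (auto simp: orth_range_iff)
qed

lemma blaschke_product_imp_codim:
  assumes "blaschke_product n f"
  shows "isometric_multiplier f \<and> has_left_codim ((\<lambda>h. h * f) ` hardy2) n"
proof -
  obtain \<alpha>s \<phi> where f: "f = prod_list (map blaschke_factor \<alpha>s) * fps_const \<phi>"
    and n: "length \<alpha>s = n" and \<alpha>s: "\<forall>\<alpha>\<in>set \<alpha>s. norm \<alpha> < 1" and \<phi>: "norm \<phi> = 1"
    using assms unfolding blaschke_product_def by blast
  show ?thesis
    using \<alpha>s unfolding f n [symmetric]
  proof (induction \<alpha>s)
    case Nil
    show ?case
      using \<phi> by (simp add: isometric_multiplier_const has_left_codim_def orth_range_const has_left_dim_0_iff)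
  next
    case (Cons \<alpha> \<alpha>s)
    let ?g = "prod_list (map blaschke_factor \<alpha>s) * fps_const \<phi>"
    have IH: "isometric_multiplier ?g" "has_left_codim ((\<lambda>h. h * ?g) ` hardy2) (length \<alpha>s)"
      and \<alpha>: "norm \<alpha> < 1"
      using Cons by auto
    have "prod_list (map blaschke_factor (\<alpha> # \<alpha>s)) * fps_const \<phi> = blaschke_factor \<alpha> * ?g"
      by (simp add: mult.assoc)
    moreover have "has_left_codim ((\<lambda>h. h * (blaschke_factor \<alpha> * ?g)) ` hardy2) (Suc (length \<alpha>s))"
      using has_left_dim_extend [OF IH(2) [unfolded has_left_codim_def] orth_range_blaschke_mult(2) [OF \<alpha> IH(1)]]
      unfolding has_left_codim_def orth_range_blaschke_mult(1) [OF \<alpha> IH(1)] .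
    moreover have "isometric_multiplier (blaschke_factor \<alpha> * ?g)"
      by (intro isometric_multiplier_mult isometric_multiplier_blaschke_factor \<alpha> IH)
    ultimately show ?case by simp
  qed
qed

text \<open>Conjugation by a unimodular constant is an automorphism that fixes z and respects
  quaternion conjugation, so it maps one Blaschke factor to another.\<close>

lemma const_mult_blaschke_factor:
  assumes "norm \<phi> = 1"
  shows "fps_const \<phi> * blaschke_factor \<alpha> = blaschke_factor (\<phi> * \<alpha> * qcnj \<phi>) * fps_const \<phi>"
proof -
  note \<phi> = const_mult_qcnj [OF assms]
  have "(\<phi> * qcnj \<alpha> * qcnj \<phi>) ^ k * \<phi> = \<phi> * qcnj \<alpha> ^ k" for k
  proof (induction k)
    case (Suc k)
    have "(\<phi> * qcnj \<alpha> * qcnj \<phi>) ^ Suc k * \<phi> = \<phi> * qcnj \<alpha> * (qcnj \<phi> * (\<phi> * qcnj \<alpha> ^ k))"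
      by (simp add: mult.assoc flip: Suc.IH)
    also have "\<dots> = \<phi> * qcnj \<alpha> ^ Suc k"
      by (simp add: \<phi> mult.assoc flip: mult.assoc [of "qcnj \<phi>" \<phi>])
    finally show ?case .
  qed simp
  then have "szego (\<phi> * \<alpha> * qcnj \<phi>) * fps_const \<phi> = fps_const \<phi> * szego \<alpha>"
    by (intro fps_ext) (simp add: qcnj_mult mult.assoc)
  moreover have "fps_const \<phi> * (fps_X - fps_const \<alpha>) = (fps_X - fps_const (\<phi> * \<alpha> * qcnj \<phi>)) * fps_const \<phi>"
    by (simp add: algebra_simps \<phi> mult.assoc flip: fps_mult_fps_X_commute)
  ultimately show ?thesis
    by (simp add: blaschke_factor_eq mult.assoc) (simp flip: mult.assoc)
qed

lemma blaschke_product_mult_blaschke_factor: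
  assumes "blaschke_product n g" "norm \<alpha> < 1"
  shows "blaschke_product (Suc n) (g * blaschke_factor \<alpha>)"
proof -
  obtain \<alpha>s \<phi> where g: "g = prod_list (map blaschke_factor \<alpha>s) * fps_const \<phi>"
    and n: "length \<alpha>s = n" and \<alpha>s: "\<forall>\<alpha>\<in>set \<alpha>s. norm \<alpha> < 1" and \<phi>: "norm \<phi> = 1"
    using assms unfolding blaschke_product_def by blast
  let ?\<alpha> = "\<phi> * \<alpha> * qcnj \<phi>"
  have "g * blaschke_factor \<alpha> = prod_list (map blaschke_factor (\<alpha>s @ [?\<alpha>])) * fps_const \<phi>"
    by (simp add: g mult.assoc const_mult_blaschke_factor \<phi>)
  moreover have "length (\<alpha>s @ [?\<alpha>]) = Suc n" "\<forall>\<alpha>\<in>set (\<alpha>s @ [?\<alpha>]). norm \<alpha> < 1"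
    using n \<alpha>s \<phi> assms(2) by (auto simp: norm_mult)
  ultimately show ?thesis
    unfolding blaschke_product_def using \<phi> by blast
qed

text \<open>An eigenvector of the shift has coefficients \<open>c ^ k * y0\<close>. Multiplying by
  \<open>inverse y0\<close> on the left turns them into powers of one quaternion, and their square
  summability forces its modulus below 1.\<close>

lemma szego_mem_orth_range:
  assumes "isometric_multiplier f" "has_left_codim ((\<lambda>h. h * f) ` hardy2) (Suc n)"
  shows "\<exists>\<alpha>. norm \<alpha> < 1 \<and> szego \<alpha> \<in> hardy2_orth ((\<lambda>h. h * f) ` hardy2)"
proof -
  let ?V = "hardy2_orth ((\<lambda>h. h * f) ` hardy2)"
  obtain y c where y: "y \<in> ?V" "y \<noteq> 0" and c: "fps_shift 1 y = fps_const c * y"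
    using shift_eigenvector [of ?V n] shift_orth_range [OF assms(1)] assms(2)
    unfolding has_left_codim_def by blast
  define y0 where "y0 = fps_nth y 0"
  have y_nth: "fps_nth y k = c ^ k * y0" for k
  proof (induction k)
    case (Suc k)
    have "fps_nth y (Suc k) = fps_nth (fps_shift 1 y) k" by simp
    then show ?case by (simp add: c Suc mult.assoc del: One_nat_def)
  qed (simp add: y0_def)
  then have y0: "y0 \<noteq> 0"
    using y(2) by (auto simp: fps_eq_iff)
  define \<alpha> where "\<alpha> = qcnj (inverse y0 * c * y0)"
  have "inverse y0 * (c ^ k * y0) = (inverse y0 * c * y0) ^ k" for k
  proof (induction k)
    case (Suc k)
    have "inverse y0 * (c ^ Suc k * y0) = inverse y0 * c * (y0 * (inverse y0 * (c ^ k * y0)))"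
      using y0 by (simp add: mult.assoc flip: mult.assoc [of y0])
    then show ?case by (simp add: Suc mult.assoc)
  qed (use y0 in simp)
  then have szego: "szego \<alpha> = fps_const (inverse y0) * y"
    by (simp add: fps_eq_iff \<alpha>_def y_nth)
  have "y \<in> hardy2"
    using y(1) by (simp add: orth_range_iff)
  then have mem: "szego \<alpha> \<in> ?V"
    using y(1) isometric_multiplier_mem [OF assms(1)]
    by (simp add: szego orth_range_iff hardy2_const_mult hardy2_inner_const_right)
  then have "summable (\<lambda>k. (norm (fps_nth (szego \<alpha>) k))\<^sup>2)"
    by (intro hardy2_summable) (simp add: orth_range_iff)
  then have "summable (\<lambda>k. ((norm \<alpha>)\<^sup>2) ^ k)"
    by (simp add: norm_power mult.commute flip: power_mult)
  then have "norm \<alpha> < 1"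
    by (simp add: summable_geometric_iff abs_square_less_1)
  then show ?thesis using mem by blast
qed

lemma codim_imp_blaschke_product:
  assumes "isometric_multiplier f" "has_left_codim ((\<lambda>h. h * f) ` hardy2) n"
  shows "blaschke_product n f"
  using assms
proof (induction n arbitrary: f)
  case 0
  have "fps_shift 1 f = 0"
    using shift_self_mem_orth_range [OF "0.prems"(1)] "0.prems"(2)
    by (simp add: has_left_codim_def has_left_dim_0_iff)
  then have "fps_nth f (Suc k) = 0" for k
    by (auto simp: fps_eq_iff)
  then have f: "f = fps_const (fps_nth f 0)"
    by (intro fps_ext) (auto simp: gr0_conv_Suc)
  have "hardy2_norm (1 * f) = hardy2_norm 1"
    using "0.prems"(1) hardy2_1 unfolding isometric_multiplier_def by blast
  then have "norm (fps_nth f 0) = 1"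
    using hardy2_norm_const [of 1] hardy2_norm_const [of "fps_nth f 0"] by (simp flip: f)
  then show ?case
    unfolding blaschke_product_def using f by auto
next
  case (Suc n)
  let ?V = "hardy2_orth ((\<lambda>h. h * f) ` hardy2)"
  obtain \<alpha> where \<alpha>: "norm \<alpha> < 1" and k: "szego \<alpha> \<in> ?V"
    using szego_mem_orth_range [OF Suc.prems] by blast
  let ?b = "blaschke_factor \<alpha>" and ?k = "szego \<alpha>"
  have b: "isometric_multiplier ?b"
    using \<alpha> by (rule isometric_multiplier_blaschke_factor)
  have k_mem: "?k \<in> hardy2"
    using \<alpha> by (rule szego_mem)
  \<comment> \<open>The kernel is orthogonal to all of H^2 f, so every h f is divisible by the
    Blaschke factor; h = 1 yields g.\<close>
  have divides: "\<exists>h'\<in>hardy2. h * f = h' * ?b" if "h \<in> hardy2" for h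
    using that k blaschke_factor_divides [OF \<alpha> isometric_multiplier_mem [OF Suc.prems(1) that]]
    by (simp add: orth_range_iff)
  obtain g where g: "f = g * ?b"
    using divides [of 1] by auto
  have g_mem: "h * g \<in> hardy2" if h: "h \<in> hardy2" for h
  proof -
    obtain h' where h': "h' \<in> hardy2" "h * f = h' * ?b"
      using divides [OF h] by blast
    then have "h * g * ?b = h' * ?b" by (simp add: g mult.assoc)
    then show ?thesis using h' blaschke_factor_nonzero by auto
  qed
  have g_iso: "isometric_multiplier g"
    unfolding isometric_multiplier_def
  proof (intro ballI conjI g_mem)
    fix h assume h: "h \<in> hardy2"
    have "hardy2_norm (h * g) = hardy2_norm (h * g * ?b)"
      using b g_mem [OF h] by (simp add: isometric_multiplier_def)
    also have "\<dots> = hardy2_norm h"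
      using Suc.prems(1) h by (simp add: isometric_multiplier_def g mult.assoc)
    finally show "hardy2_norm (h * g) = hardy2_norm h" .
  qed
  let ?W = "hardy2_orth ((\<lambda>h. h * g) ` hardy2)"
  have V_mem: "x \<in> hardy2" if "x \<in> ?V" for x
    using that by (simp add: orth_range_iff)
  have inner_b: "hardy2_inner (h * f) (x * ?b) = hardy2_inner (h * g) x" if "h \<in> hardy2" "x \<in> hardy2" for h x
    using isometric_multiplier_inner [OF b g_mem [OF that(1)] that(2)] by (simp add: g mult.assoc)
  \<comment> \<open>Being orthogonal to k means being divisible by the Blaschke factor, and since
    that factor is isometric, \<open>inner_b\<close> transfers orthogonality between H^2 f and H^2
    g. The pairing with k is nonzero at k itself, so passing to its kernel lowers the dimension by
    one.\<close>
  have "(\<lambda>x. x * ?b) ` ?W = {x \<in> ?V. hardy2_inner x ?k = 0}"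
  proof (intro equalityI subsetI)
    fix x assume "x \<in> (\<lambda>x. x * ?b) ` ?W"
    then show "x \<in> {x \<in> ?V. hardy2_inner x ?k = 0}"
      using isometric_multiplier_mem [OF b]
      by (auto simp: orth_range_iff inner_b hardy2_inner_mult_blaschke_szego \<alpha>)
  next
    fix x assume x: "x \<in> {x \<in> ?V. hardy2_inner x ?k = 0}"
    then obtain x' where "x' \<in> hardy2" "x = x' * ?b"
      using blaschke_factor_divides [OF \<alpha> V_mem] by blast
    then show "x \<in> (\<lambda>x. x * ?b) ` ?W"
      using x by (auto simp: orth_range_iff inner_b)
  qed
  moreover have "has_left_dim {x \<in> ?V. hardy2_inner x ?k = 0} n"
  proof (rule has_left_dim_kernel [where e = ?k])
    show "has_left_dim ?V (Suc n)"
      using Suc.prems(2) by (simp add: has_left_codim_def)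
    show "hardy2_inner ?k ?k \<noteq> 0"
      using hardy2_inner_self_eq_0 [OF k_mem] szego_nonzero by blast
  qed (use k k_mem V_mem in \<open>simp_all add: hardy2_inner_add_left hardy2_inner_const_left\<close>)
  ultimately have "has_left_dim ?W n"
    using has_left_dim_mult_right_cancel blaschke_factor_nonzero by metis
  then have "blaschke_product n g"
    using Suc.IH [OF g_iso] by (simp add: has_left_codim_def)
  then show ?case
    unfolding g using \<alpha> by (rule blaschke_product_mult_blaschke_factor)
qed

theorem theorem5p2:
  fixes f :: "quat fps" and n :: nat
  shows "blaschke_product n f \<longleftrightarrow>
    (\<forall>h\<in>hardy2. h * f \<in> hardy2 \<and> hardy2_norm (h * f) = hardy2_norm h) \<and>
    has_left_codim ((\<lambda>h. h * f) ` hardy2) n"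
  using blaschke_product_imp_codim codim_imp_blaschke_product
  unfolding isometric_multiplier_def by blast

end
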